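(* Let $\mathcal H$ be a real Hilbert space, $\Phi:\mathcal H\to\mathbb R$ and $\Psi_1:\mathcal H\to\mathbb R$ convex differentiable functions, and $\Phi_2,\Psi_2:\mathcal H\to\mathbb R\cup\{+\infty\}$ proper lower-semicontinuous convex functions, with $\min\Psi_1=\min\Psi_2=0$ and $C=\operatorname{Argmin}\Psi_1\cap\operatorname{Argmin}\Psi_2\neq\emptyset$. Set $A=\partial\Phi_2$. Let $(\lambda_n)_{n\ge1}$ and $(\beta_n)_{n\ge 1}$ be sequences of positive numbers. Assume: (a) $\mathbf T=A+\nabla\Phi+N_C$ is maximal monotone and $S=\mathbf T^{-1}(0)\neq\emptyset$; (b) $\nabla\Phi$ is $L_\Phi$-Lipschitz-continuous and $\nabla\Psi_1$ is $L_{\Psi_1}$-Lipschitz-continuous; (c) for each $z\in N_C(\mathcal H)$, $\sum_{n=1}^\infty\lambda_n\beta_n\left[(\Psi_1+\Psi_2)^*\left(\frac{z}{\beta_n}\right)-\sigma_C\left(\frac{z}{\beta_n}\right)\right]<\infty$; (d) $\sum_{n=1}^\infty\lambda_n=+\infty$, $\sum_{n=1}^\infty L_\Phi\lambda_n^2<+\infty$, and $\limsup_{n\to\infty}(L_{\Psi_1}\lambda_n\beta_n)<2$. Assume further that any one of the following conditions holds: (i) $\liminf_{n\to\infty}\lambda_n\beta_n>0$ and the function $\Phi+\Phi_2$ or the function $\Psi_1+\Psi_2$ is boundedly inf-compact; (ii) $\liminf_{n\to\infty}\lambda_n\beta_n>0$, $(\lambda_n)$ is bounded, and $\beta_{n+1}-\beta_n\le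 K\lambda_{n+1}\beta_{n+1}$ for some $K>0$ (and all $n$); or (iii) $\Psi_1=\Psi_2=0$. Let $(x_n)$ be a sequence generated by the splitting forward-backward penalty algorithm (SFBP). Then $(x_n)$ converges weakly to a point in $S$ as $n\to\infty$. Moreover, in case (i), convergence is strong if $\Psi_1+\Psi_2$ is boundedly inf-compact. In cases (ii) and (iii), the sequence $(x_n)$ minimizes $\Phi+\Phi_2$ over $C$ in the sense that $$\lim_{n\to\infty}(\Phi+\Phi_2)(x_n)=\min_C(\Phi+\Phi_2).$$
   Context: $N_C$ is the (outward) normal cone operator of the closed convex set $C$: $N_C(x)=\{x^*\in\mathcal H:\langle x^*,c-x\rangle\le0\ \forall c\in C\}$ if $x\in C$ and $N_C(x)=\emptyset$ otherwise; $N_C(\mathcal H)=\bigcup_{x\in\mathcal H}N_C(x)$ is its range. $\sigma_C(x^* )=\sup_{c\in C}\langle x^*,c\rangle$ is the support function of $C$. $F^*(x^* )=\sup_{y\in\mathcal H}\{\langle y,x^*\rangle-F(y)\}$ is the Fenchel conjugate of $F$. The case $L_\Phi=0$ (respectively $L_{\Psi_1}=0$) is allowed when $\Phi$ is affine (respectively $\Psi_1\equiv0$). A function $F:\mathcal H\to\mathbb R\cup\{+\infty\}$ is boundedly inf-compact if the sets $\{x\in\mathcal H:\|x\|\le R\text{ and }F(x)\le M\}$ are relatively compact for every $R\ge0$ and $M\in\mathbb R$. A sequence $(x_n)$ is generated by (SFBP) if $x_1\in\mathcal H$ and, for all $n\ge1$, $$x_{n+1}=(I+\lambda_nA+\lambda_n\beta_n\partial\Psi_2)^{-1}\big(x_n-\lambda_n\nabla\Phi(x_n)-\lambda_n\beta_n\nabla\Psi_1(x_n)\big),$$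 that is, $$\frac{x_n-x_{n+1}}{\lambda_n}-\nabla\Phi(x_n)-\beta_n\nabla\Psi_1(x_n)\in Ax_{n+1}+\beta_n\partial\Psi_2(x_{n+1}).$$ Existence of such a sequence is taken for granted. *)

theory Defs
  imports "HOL-Analysis.Analysis"
begin

text \<open>
  Functions with values in the reals extended by plus infinity are rendered as
  \<open>ereal\<close>-valued functions; the value \<open>-\<infinity>\<close> is excluded by \<open>proper_fun\<close>.
\<close>

definition proper_fun :: "('a \<Rightarrow> ereal) \<Rightarrow> bool" where
  "proper_fun F \<longleftrightarrow> (\<forall>x. F x \<noteq> -\<infinity>) \<and> (\<exists>x. F x \<noteq> \<infinity>)"

definition lsc_fun :: "('a::topological_space \<Rightarrow> ereal) \<Rightarrow> bool" where
  "lsc_fun F \<longleftrightarrow> (\<forall>x. F x \<le> Liminf (at x) F)"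

text \<open>
  Jensen's inequality is the right notion only in the absence of the value \<open>-\<infinity>\<close>
  (recall that \<open>\<infinity> + -\<infinity> = \<infinity>\<close> in \<open>ereal\<close>); it is used together with \<open>proper_fun\<close>.
\<close>

definition convex_fun :: "('a::real_vector \<Rightarrow> ereal) \<Rightarrow> bool" where
  "convex_fun F \<longleftrightarrow>
    (\<forall>x y t. 0 < t \<and> t < 1 \<longrightarrow>
      F ((1 - t) *\<^sub>R x + t *\<^sub>R y) \<le> ereal (1 - t) * F x + ereal t * F y)"

definition argmin_set :: "('a \<Rightarrow> 'b::linorder) \<Rightarrow> 'a set" where
  "argmin_set F = {x. \<forall>y. F x \<le> F y}"

text \<open>\<open>is_min_on F D m\<close>: the minimum of \<open>F\<close> over \<open>D\<close> is attained and equals \<open>m\<close>.\<close>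

definition is_min_on :: "('a \<Rightarrow> 'b::linorder) \<Rightarrow> 'a set \<Rightarrow> 'b \<Rightarrow> bool" where
  "is_min_on F D m \<longleftrightarrow> (\<exists>x\<in>D. F x = m) \<and> (\<forall>x\<in>D. m \<le> F x)"

text \<open>
  Set-valued operators are functions into \<open>'a set\<close>, with the empty set outside the domain.
\<close>

definition subdiff :: "('a::real_inner \<Rightarrow> ereal) \<Rightarrow> 'a \<Rightarrow> 'a set" where
  "subdiff F x = {u. \<bar>F x\<bar> \<noteq> \<infinity> \<and> (\<forall>y. F x + ereal (inner u (y - x)) \<le> F y)}"

definition normal_cone :: "'a::real_inner set \<Rightarrow> 'a \<Rightarrow> 'a set" where
  "normal_cone C x = (if x \<in> C then {u. \<forall>c\<in>C. inner u (c - x) \<le> 0} else {})"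

definition support_fun :: "'a::real_inner set \<Rightarrow> 'a \<Rightarrow> ereal" where
  "support_fun C u = (SUP c\<in>C. ereal (inner u c))"

definition fenchel_conj :: "('a::real_inner \<Rightarrow> ereal) \<Rightarrow> 'a \<Rightarrow> ereal" where
  "fenchel_conj F u = (SUP y. ereal (inner y u) - F y)"

definition monotone_op :: "('a::real_inner \<Rightarrow> 'a set) \<Rightarrow> bool" where
  "monotone_op T \<longleftrightarrow> (\<forall>x y. \<forall>u\<in>T x. \<forall>v\<in>T y. 0 \<le> inner (u - v) (x - y))"

text \<open>Maximality is with respect to inclusion of graphs.\<close>

definition maximal_monotone_op :: "('a::real_inner \<Rightarrow> 'a set) \<Rightarrow> bool" where
  "maximal_monotone_op T \<longleftrightarrow>
    monotone_op T \<and> (\<forall>T'. monotone_op T' \<and> (\<forall>x. T x \<subseteq> T' x) \<longrightarrow> T' = T)"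

definition boundedly_inf_compact :: "('a::real_normed_vector \<Rightarrow> ereal) \<Rightarrow> bool" where
  "boundedly_inf_compact F \<longleftrightarrow>
    (\<forall>R\<ge>0. \<forall>M::real. compact (closure {x. norm x \<le> R \<and> F x \<le> ereal M}))"

definition weakly_converges :: "(nat \<Rightarrow> 'a::real_inner) \<Rightarrow> 'a \<Rightarrow> bool" where
  "weakly_converges x l \<longleftrightarrow> (\<forall>y. (\<lambda>n. inner (x n) y) \<longlonglongrightarrow> inner l y)"

text \<open>
  Sequences are indexed from 1; the value at index 0 is irrelevant. The sum of the singleton
  and the other sets is the Minkowski sum, so it is empty as soon as one summand is empty.
  \<open>gPhi\<close> and \<open>gPsi1\<close> are the gradients of the smooth functions, and \<open>A\<close> is a set-valued operator.
  The inclusion says that \<open>x (n + 1)\<close> is the image of the explicit step under the resolvent of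
  \<open>lam n *\<^sub>R A + (lam n * bet n) *\<^sub>R subdiff Psi2\<close>.
\<close>

definition SFBP ::
  "('a::real_inner \<Rightarrow> 'a set) \<Rightarrow> ('a \<Rightarrow> 'a) \<Rightarrow> ('a \<Rightarrow> 'a) \<Rightarrow> ('a \<Rightarrow> ereal) \<Rightarrow>
    (nat \<Rightarrow> real) \<Rightarrow> (nat \<Rightarrow> real) \<Rightarrow> (nat \<Rightarrow> 'a) \<Rightarrow> bool" where
  "SFBP A gPhi gPsi1 Psi2 lam bet x \<longleftrightarrow>
    (\<forall>n\<ge>1. (x n - x (n + 1)) /\<^sub>R lam n - gPhi (x n) - bet n *\<^sub>R gPsi1 (x n)
       \<in> A (x (n + 1)) + (\<lambda>v. bet n *\<^sub>R v) ` subdiff Psi2 (x (n + 1)))"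

end

theory Submission
  imports Defs
begin

text \<open>
Write \<open>F = Phi + Phi2\<close> and \<open>Psi = Psi1 + Psi2\<close>. Both the explicit and the implicit part of the operator
are (sub)gradients, so the argument runs on function values.

\<^item> Reformulation of the solution set. The operator \<open>T\<close> is contained in the subdifferential of \<open>F\<close>
restricted to \<open>C\<close>, which is monotone; by maximality the two coincide, so \<open>S\<close> is the set of
minimizers of \<open>F\<close> over \<open>C\<close> (\<open>zeros_eq_constrained_minimizers\<close>).

\<^item> Energy. Testing one step against \<open>u \<in> S\<close> and using the descent lemma for \<open>Phi\<close> and the cocoercivity
of the gradient of \<open>Psi1\<close> gives, for all large \<open>n\<close> and some \<open>\<theta> > 0\<close>,
\<open>\<parallel>x\<^sub>n\<^sub>+\<^sub>1 - u\<parallel>\<^sup>2 + \<theta> \<lambda>\<^sub>n \<beta>\<^sub>n Psi (x\<^sub>n\<^sub>+\<^sub>1) + 2 \<lambda>\<^sub>n (F (x\<^sub>n\<^sub>+\<^sub>1) - F u) \<le> \<parallel>x\<^sub>n - u\<parallel>\<^sup>2\<close>.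
The last term on the left may be negative because \<open>x\<^sub>n\<^sub>+\<^sub>1\<close> need not lie in \<open>C\<close>. Fenchel's inequality bounds
its negative part by half of the penalty term plus a multiple of the conjugate gaps, which are summable
by assumption. So \<open>\<parallel>x\<^sub>n - u\<parallel>\<close> converges for every \<open>u \<in> S\<close>, and \<open>\<lambda>\<^sub>n \<beta>\<^sub>n Psi (x\<^sub>n\<^sub>+\<^sub>1)\<close> and
\<open>\<lambda>\<^sub>n \<bar>F (x\<^sub>n\<^sub>+\<^sub>1) - min F\<bar>\<close> are summable (\<open>energy_estimate\<close>).

\<^item> \<open>case_i\<close>. As \<open>\<lambda>\<^sub>n\<close> is not summable, \<open>F (x\<^sub>n) \<rightarrow> min F\<close> along a subsequence; inf-compactness gives it a strong
cluster point, which lies in \<open>S\<close>. The distance of \<open>x\<^sub>n\<close> to this point converges, hence tends to \<open>0\<close>. Thus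
convergence is strong whichever of the two functions is inf-compact (\<open>strong_convergence\<close>).

\<^item> \<open>case_ii\<close> and \<open>case_iii\<close>. The penalized value \<open>F (x\<^sub>n) - min F + \<beta>\<^sub>n\<^sub>-\<^sub>1 Psi (x\<^sub>n)\<close> is summable against the step
sizes, and the descent property of one step together with the growth condition on \<open>\<beta>\<close> lets it
increase by at most a factor \<open>1 + c \<lambda>\<^sub>n\<close> plus a summable error. On stretches of total step length \<open>1\<close> it
must be small somewhere and can only grow by a bounded factor afterwards, so its positive part
tends to \<open>0\<close> (\<open>slow_growth_tendsto_zero\<close>, \<open>limsup_gap_nonpos\<close>).

\<^item> Weak limits. In place of weak compactness and Mazur's lemma, weak limits are constructed as
asymptotic centers: the asymptotic center of a bounded sequence along a filter exists by strong
convexity of the squared norm, and projections show that it belongs to every closed convex set that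
eventually contains the sequence, in particular to the sublevel sets of \<open>F\<close> and \<open>Psi\<close>. Convergence of
\<open>\<parallel>x\<^sub>n - u\<parallel>\<close> for all \<open>u \<in> S\<close> makes the center independent of the filter, which is weak convergence
(\<open>quasi_fejer_weak_convergence\<close>).
\<close>

section \<open>Convex functions with Lipschitz gradient\<close>

locale smooth_convex =
  fixes f :: "'a::real_inner \<Rightarrow> real" and g :: "'a \<Rightarrow> 'a" and L :: real
  assumes convex: "convex_on UNIV f"
    and gderiv: "GDERIV f y :> g y"
    and lipschitz: "L-lipschitz_on UNIV g"
begin

lemma deriv_on_line:
  "((\<lambda>t. f (y + t *\<^sub>R d)) has_real_derivative inner (g (y + t *\<^sub>R d)) d) (at t)"
proof -
  have "((\<lambda>t::real. y + t *\<^sub>R d) has_derivative (\<lambda>h. h *\<^sub>R d)) (at t)"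
    by (auto intro!: derivative_eq_intros)
  from has_derivative_compose[OF this, of f] gderiv[of "y + t *\<^sub>R d"]
  have "((\<lambda>t. f (y + t *\<^sub>R d)) has_derivative (\<lambda>h. inner (h *\<^sub>R d) (g (y + t *\<^sub>R d)))) (at t)"
    unfolding gderiv_def by blast
  then show ?thesis
    unfolding has_field_derivative_def
    by (rule has_derivative_eq_rhs) (auto simp: inner_commute mult.commute)
qed

lemma lipschitz_norm: "norm (g y - g z) \<le> L * norm (y - z)"
  using lipschitz_onD[OF lipschitz, of y z] by (simp add: dist_norm)

lemma L_nonneg: "0 \<le> L"
  by (rule lipschitz_on_nonneg[OF lipschitz])

lemma above_tangent: "f y + inner (g y) (z - y) \<le> f z"
proof -
  have "convex_on UNIV (\<lambda>t. f (y + t *\<^sub>R (z - y)))"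
  proof (rule convex_onI)
    fix t a b :: real assume t: "0 < t" "t < 1"
    have "y + ((1 - t) *\<^sub>R a + t *\<^sub>R b) *\<^sub>R (z - y) =
        (1 - t) *\<^sub>R (y + a *\<^sub>R (z - y)) + t *\<^sub>R (y + b *\<^sub>R (z - y))"
      by (simp add: algebra_simps)
    then show "f (y + ((1 - t) *\<^sub>R a + t *\<^sub>R b) *\<^sub>R (z - y))
        \<le> (1 - t) * f (y + a *\<^sub>R (z - y)) + t * f (y + b *\<^sub>R (z - y))"
      using convex_onD[OF convex, of t] t by simp
  qed simp
  from convex_on_imp_above_tangent[OF this, of 0 1 "inner (g y) (z - y)"]
    deriv_on_line[of y "z - y" 0]
  show ?thesis by simp
qed

lemma quadratic_upper_bound: "f z \<le> f y + inner (g y) (z - y) + L / 2 * (norm (z - y))\<^sup>2"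
proof -
  define d where "d = z - y"
  let ?k = "\<lambda>t. f (y + t *\<^sub>R d) - t * inner (g y) d - L / 2 * t\<^sup>2 * (norm d)\<^sup>2"
  have "?k 1 \<le> ?k 0"
  proof (rule DERIV_nonpos_imp_nonincreasing[of 0 1 ?k])
    fix t :: real assume "0 \<le> t" "t \<le> 1"
    let ?D = "inner (g (y + t *\<^sub>R d)) d - inner (g y) d - L * t * (norm d)\<^sup>2"
    have D: "(?k has_real_derivative ?D) (at t)"
      by (auto intro!: derivative_eq_intros deriv_on_line)
    have "inner (g (y + t *\<^sub>R d) - g y) d \<le> norm (g (y + t *\<^sub>R d) - g y) * norm d"
      by (rule norm_cauchy_schwarz)
    also have "\<dots> \<le> L * norm (y + t *\<^sub>R d - y) * norm d"
      by (intro mult_right_mono lipschitz_norm) auto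
    finally have "?D \<le> 0"
      using \<open>0 \<le> t\<close> by (simp add: inner_diff_left power2_eq_square)
    with D show "\<exists>D. (?k has_real_derivative D) (at t) \<and> D \<le> 0" by blast
  qed simp
  then show ?thesis by (simp add: d_def)
qed

lemma continuous: "continuous_on UNIV f"
proof (rule continuous_at_imp_continuous_on, rule ballI)
  fix y
  show "continuous (at y) f"
    using gderiv[of y] unfolding gderiv_def by (rule has_derivative_continuous)
qed

lemma gradient_at_minimum:
  assumes "\<And>y. f u \<le> f y"
  shows "g u = 0"
proof -
  have "((\<lambda>t. f (u + t *\<^sub>R g u)) has_real_derivative inner (g u) (g u)) (at 0)"
    using deriv_on_line[of u "g u" 0] by simp
  moreover have "\<forall>y. \<bar>0 - y\<bar> < 1 \<longrightarrow> f (u + 0 *\<^sub>R g u) \<le> f (u + y *\<^sub>R g u)"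
    using assms by simp
  ultimately have "inner (g u) (g u) = 0"
    using DERIV_local_min[of "\<lambda>t. f (u + t *\<^sub>R g u)" "inner (g u) (g u)" 0 1] by auto
  then show ?thesis by simp
qed

text \<open>
A gradient step of length \<open>1 / L\<close> decreases \<open>f\<close> by \<open>\<parallel>g y\<parallel>\<^sup>2 / (2 L)\<close>, but not below the minimum. In this
product form the inequality also covers \<open>L = 0\<close>, where \<open>g\<close> is constant and hence zero.
\<close>
lemma gradient_norm_le_gap:
  assumes "\<And>y. f u \<le> f y"
  shows "(norm (g y))\<^sup>2 \<le> 2 * L * (f y - f u)"
proof (cases "L = 0")
  case True
  with lipschitz_norm[of y u] gradient_at_minimum[OF assms] show ?thesis by simp
next
  case False
  with L_nonneg have L: "L > 0" by simp
  have "f u \<le> f (y - (1 / L) *\<^sub>R g y)" by (rule assms)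
  also have "\<dots> \<le> f y - (norm (g y))\<^sup>2 / (2 * L)"
    using quadratic_upper_bound[of "y - (1 / L) *\<^sub>R g y" y] L
    by (simp add: power2_norm_eq_inner[symmetric] power_mult_distrib power2_eq_square field_simps)
  finally show ?thesis using L by (simp add: field_simps)
qed

text \<open>
The tangent plane at \<open>y\<close> lies below \<open>f\<close>, and \<open>f\<close> lies below a paraboloid at the minimizer \<open>u\<close>; the two are
compared at the point \<open>u + g y / L\<close>. Adding \<open>gradient_norm_le_gap\<close> yields cocoercivity of \<open>g\<close> at \<open>u\<close>, but
keeping them apart leaves a multiple of the value \<open>f y - f u\<close> to spare.
\<close>
lemma gradient_norm_le_linearization_gap:
  assumes "\<And>y. f u \<le> f y"
  shows "(norm (g y))\<^sup>2 \<le> 2 * L * (inner (g y) (y - u) - (f y - f u))"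
proof (cases "L = 0")
  case True
  with lipschitz_norm[of y u] gradient_at_minimum[OF assms]
  show ?thesis using above_tangent[of u y] by simp
next
  case False
  with L_nonneg have L: "L > 0" by simp
  let ?w = "u + (1 / L) *\<^sub>R g y"
  have "f y + inner (g y) (?w - y) \<le> f ?w"
    by (rule above_tangent)
  moreover have "f ?w \<le> f u + (norm (g y))\<^sup>2 / (2 * L)"
    using quadratic_upper_bound[of ?w u] gradient_at_minimum[OF assms] L
    by (simp add: power_mult_distrib power2_eq_square field_simps)
  moreover have "inner (g y) (?w - y) = (norm (g y))\<^sup>2 / L - inner (g y) (y - u)"
    by (simp add: inner_diff_right inner_add_right power2_norm_eq_inner field_simps)
  ultimately show ?thesis using L by (simp add: field_simps)
qed

end

text \<open>
Nonnegativity of the quadratic form left over in one explicit step: its diagonal coefficients have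
product at least \<open>1\<close>, while the mixed coefficient is at most \<open>2\<close>. The factor \<open>5\<close> makes
\<open>(2 - \<theta> / 2) (1 - 2 \<theta>) \<ge> s\<close>.
\<close>
lemma quadratic_form_bound:
  fixes s \<theta> a d :: real
  assumes "0 < s" "0 < \<theta>" "s + 5 * \<theta> \<le> 2" "0 \<le> a" "0 \<le> d"
  shows "(2 - \<theta>) * a * d \<le> (2 - \<theta> / 2) / s * a\<^sup>2 + (1 - \<theta> * s / 2 - \<theta>) * d\<^sup>2"
proof -
  define c where "c = 1 - 2 * \<theta>"
  have c: "c > 0" using assms by (simp add: c_def)
  have "s * inverse c \<le> 2 - \<theta> / 2"
  proof -
    have "s \<le> (2 - \<theta> / 2) * c"
    proof -
      have "(2 - \<theta> / 2) * c = 2 - 9 / 2 * \<theta> + \<theta> * \<theta>" by (simp add: c_def algebra_simps)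
      moreover have "0 \<le> \<theta> * \<theta>" by simp
      ultimately show ?thesis using assms by linarith
    qed
    then show ?thesis using c by (simp add: field_simps)
  qed
  then have "inverse c \<le> (2 - \<theta> / 2) / s"
    using assms(1) by (simp add: field_simps)
  then have "inverse c * a\<^sup>2 \<le> (2 - \<theta> / 2) / s * a\<^sup>2"
    by (rule mult_right_mono) simp
  moreover have "c * d\<^sup>2 \<le> (1 - \<theta> * s / 2 - \<theta>) * d\<^sup>2"
  proof (rule mult_right_mono)
    have "\<theta> * s \<le> \<theta> * 2" using assms by (intro mult_left_mono) auto
    then show "c \<le> 1 - \<theta> * s / 2 - \<theta>" by (simp add: c_def)
  qed simp
  moreover have "2 * (a * d) \<le> inverse c * a\<^sup>2 + c * d\<^sup>2"
    using zero_le_power2[of "a - c * d"] c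
    by (simp add: field_simps power2_eq_square)
  moreover have "(2 - \<theta>) * a * d \<le> 2 * (a * d)"
    using assms by (simp add: algebra_simps)
  ultimately show ?thesis by linarith
qed

context smooth_convex
begin

text \<open>
For \<open>\<theta> = 0\<close> and \<open>L * b \<le> 2\<close> this is the usual stability bound for an explicit gradient step of length \<open>b\<close>.
A strict bound \<open>L * b < 2\<close> leaves room for a small \<open>\<theta>\<close>, which pays for a multiple of the value at the
new point \<open>x'\<close>. That value is needed because the implicit part of the algorithm controls the other
penalty function at \<open>x'\<close> and not at \<open>x\<close>.
\<close>
lemma explicit_step_gap:
  assumes min: "\<And>y. f u \<le> f y" and b: "0 \<le> b" and \<theta>: "0 < \<theta>" "L * b + 5 * \<theta> \<le> 2"
  shows "\<theta> * b * (f x' - f u) + \<theta> * (norm (x' - x))\<^sup>2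
      \<le> 2 * b * inner (g x) (x' - u) + (norm (x' - x))\<^sup>2"
proof -
  define d where "d = norm (x' - x)"
  define a where "a = b * norm (g x)"
  \<comment> \<open>the values at the old and at the new point; \<open>j + i\<close> splits the inner product at the old point\<close>
  define P where "P = f x - f u"
  define Q where "Q = f x' - f u"
  define i where "i = inner (g x) (x' - x)"
  define j where "j = inner (g x) (x - u)"
  have th: "\<theta> \<le> 2/5" using \<theta> mult_nonneg_nonneg[OF L_nonneg b] by simp
  have split: "inner (g x) (x' - u) = j + i"
    by (simp add: i_def j_def inner_diff_right)
  have up: "Q \<le> P + i + L / 2 * d\<^sup>2"
    using quadratic_upper_bound[of x' x] by (simp add: P_def Q_def i_def d_def)
  have i: "\<bar>b * i\<bar> \<le> a * d"
    using Cauchy_Schwarz_ineq2[of "g x" "x' - x"] b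
    by (simp add: a_def d_def i_def abs_mult mult_left_mono mult.assoc)
  have gP: "(norm (g x))\<^sup>2 \<le> 2 * L * P" and gj: "(norm (g x))\<^sup>2 \<le> 2 * L * (j - P)"
    using gradient_norm_le_gap[OF min, of x] gradient_norm_le_linearization_gap[OF min, of x]
    by (simp_all add: P_def j_def)
  have P: "0 \<le> P" using min by (simp add: P_def)
  have jP: "P \<le> j"
    using above_tangent[of x u] by (simp add: P_def j_def inner_diff_right)
  have "(2 - \<theta>) * (a * d) \<le> 2 * b * (j - P) + (2 - \<theta>) * b * P + (1 - \<theta> * (L * b) / 2 - \<theta>) * d\<^sup>2"
  proof (cases "L * b = 0")
    case True
    then have "b = 0 \<or> L = 0" by auto
    then have "a = 0" using gP by (auto simp: a_def)
    moreover have "0 \<le> 2 * b * (j - P)" "0 \<le> (2 - \<theta>) * b * P" using th P jP b by simp_all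
    moreover have "0 \<le> (1 - \<theta> * (L * b) / 2 - \<theta>) * d\<^sup>2" unfolding True using th by simp
    ultimately show ?thesis by simp
  next
    case False
    then have s: "0 < L * b" and L: "0 < L" and b': "0 < b" using L_nonneg b by (auto simp: less_le)
    have "(2 - \<theta>) * (a * d) \<le> (2 - \<theta> / 2) / (L * b) * a\<^sup>2 + (1 - \<theta> * (L * b) / 2 - \<theta>) * d\<^sup>2"
      using quadratic_form_bound[OF s \<theta>, of a d] b by (simp add: a_def d_def mult.assoc)
    moreover have "(2 - \<theta> / 2) / (L * b) * a\<^sup>2 \<le> 2 * b * (j - P) + (2 - \<theta>) * b * P"
    proof -
      define X where "X = b * (norm (g x))\<^sup>2 / L"
      have aX: "a\<^sup>2 / (L * b) = X"
        using L b' by (simp add: X_def a_def power_mult_distrib field_simps power2_eq_square)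
      have "(2 - \<theta> / 2) / (L * b) * a\<^sup>2 = (2 - \<theta> / 2) * X"
        unfolding aX[symmetric] by (simp only: times_divide_eq_left times_divide_eq_right)
      also have "\<dots> = X + (1 - \<theta> / 2) * X" by (simp add: algebra_simps)
      finally have A: "(2 - \<theta> / 2) / (L * b) * a\<^sup>2 = X + (1 - \<theta> / 2) * X" .
      have "(norm (g x))\<^sup>2 / L \<le> 2 * (j - P)" "(norm (g x))\<^sup>2 / L \<le> 2 * P"
        using gP gj L by (simp_all add: field_simps)
      from this[THEN mult_left_mono[OF _ b]]
      have "X \<le> 2 * b * (j - P)" "X \<le> 2 * b * P"
        by (simp_all add: X_def mult.assoc mult.left_commute)
      then have "X + (1 - \<theta> / 2) * X \<le> 2 * b * (j - P) + (1 - \<theta> / 2) * (2 * b * P)"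
        using th by (intro add_mono mult_left_mono) auto
      then show ?thesis unfolding A by (simp add: algebra_simps)
    qed
    ultimately show ?thesis by linarith
  qed
  \<comment> \<open>a share \<open>\<theta>\<close> of the value at \<open>x\<close> is moved to \<open>x'\<close> by the quadratic upper bound\<close>
  moreover have "\<theta> * b * Q \<le> \<theta> * b * P + \<theta> * (b * i) + \<theta> * (L * b) / 2 * d\<^sup>2"
  proof -
    have "\<theta> * b * Q \<le> \<theta> * b * (P + i + L / 2 * d\<^sup>2)"
      using up b \<theta> by (intro mult_left_mono) auto
    then show ?thesis by (simp add: algebra_simps)
  qed
  moreover have "- ((2 - \<theta>) * (a * d)) \<le> (2 - \<theta>) * (b * i)"
  proof -
    have "(2 - \<theta>) * (- (a * d)) \<le> (2 - \<theta>) * (b * i)"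
      using i th by (intro mult_left_mono) auto
    then show ?thesis by simp
  qed
  ultimately show ?thesis
    unfolding split Q_def[symmetric] d_def[symmetric] by (simp add: algebra_simps)
qed

end

text \<open>
The numbers \<open>p\<close> and \<open>q\<close> stand for the differences of the nonsmooth functions between \<open>x'\<close> and \<open>u\<close>, which the
subgradients \<open>v\<close> and \<open>w\<close> bound. Expanding \<open>\<parallel>x - u\<parallel>\<^sup>2\<close> around \<open>x'\<close> leaves \<open>\<parallel>x' - x\<parallel>\<^sup>2\<close>: a share \<open>\<theta>\<close> of it absorbs
the error of evaluating \<open>gf\<close> at the old point, the rest goes into \<open>explicit_step_gap\<close>.
\<close>
lemma forward_backward_penalty_step:
  fixes f h :: "'a::real_inner \<Rightarrow> real"
  assumes F: "smooth_convex f gf Lf" and H: "smooth_convex h gh Lh"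
    and min: "\<And>y. h u \<le> h y"
    and l: "0 < l" and b: "0 < b"
    and step: "x - x' = l *\<^sub>R (gf x + v + b *\<^sub>R (gh x + w))"
    and v: "p \<le> inner v (x' - u)" and w: "q \<le> inner w (x' - u)" and q: "0 \<le> q"
    and \<theta>: "0 < \<theta>" "Lf * l \<le> \<theta>" "Lh * (l * b) + 5 * \<theta> \<le> 2"
  shows "(norm (x' - u))\<^sup>2 + \<theta> * (l * b) * (h x' - h u + q) + 2 * l * (f x' - f u + p)
      \<le> (norm (x - u))\<^sup>2"
proof -
  interpret f: smooth_convex f gf Lf by (rule F)
  interpret h: smooth_convex h gh Lh by (rule H)
  define d where "d = norm (x' - x)"
  have th: "\<theta> \<le> 2" using \<theta> mult_nonneg_nonneg[OF h.L_nonneg, of "l * b"] l b by simp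
  have "(norm (x - u))\<^sup>2 = (norm (x' - u))\<^sup>2 + d\<^sup>2 + 2 * inner (x - x') (x' - u)"
    by (simp add: d_def power2_norm_eq_inner inner_diff_left inner_diff_right inner_commute)
  moreover have "inner (x - x') (x' - u) = l * inner (gf x) (x' - u) + l * inner v (x' - u)
      + l * b * inner w (x' - u) + l * b * inner (gh x) (x' - u)"
    unfolding step by (simp add: inner_add_left algebra_simps)
  moreover have "l * (f x' - f u - Lf / 2 * d\<^sup>2) \<le> l * inner (gf x) (x' - u)"
  proof (rule mult_left_mono)
    show "f x' - f u - Lf / 2 * d\<^sup>2 \<le> inner (gf x) (x' - u)"
      using f.quadratic_upper_bound[of x' x] f.above_tangent[of x u]
      by (simp add: d_def inner_diff_right)
  qed (use l in simp)
  moreover have "Lf * l * d\<^sup>2 \<le> \<theta> * d\<^sup>2" using \<theta> by (intro mult_right_mono) auto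
  moreover have "l * p \<le> l * inner v (x' - u)" using v l by simp
  moreover have "l * b * q \<le> l * b * inner w (x' - u)" using w l b by simp
  moreover have "\<theta> * (l * b) * (h x' - h u) + \<theta> * d\<^sup>2 \<le> 2 * (l * b) * inner (gh x) (x' - u) + d\<^sup>2"
    unfolding d_def using h.explicit_step_gap[OF min, of "l * b" \<theta>] l b \<theta> by simp
  moreover have "\<theta> * (l * b * q) \<le> 2 * (l * b * q)"
    using th l b q by (intro mult_right_mono) auto
  ultimately show ?thesis by (simp add: algebra_simps)
qed

text \<open>
The same step tested against the old point \<open>x\<close> itself: with the penalty parameter held fixed, the
penalized objective does not increase.
\<close>
lemma forward_backward_penalty_descent:
  fixes f h :: "'a::real_inner \<Rightarrow> real"
  assumes F: "smooth_convex f gf Lf" and H: "smooth_convex h gh Lh"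
    and l: "0 < l" and b: "0 < b"
    and step: "x - x' = l *\<^sub>R (gf x + v + b *\<^sub>R (gh x + w))"
    and v: "p \<le> inner v (x' - x)" and w: "q \<le> inner w (x' - x)"
    and small: "Lf * l + Lh * (l * b) \<le> 2"
  shows "f x' + p + b * (h x' + q) \<le> f x + b * h x"
proof -
  interpret f: smooth_convex f gf Lf by (rule F)
  interpret h: smooth_convex h gh Lh by (rule H)
  define d where "d = norm (x' - x)"
  have "- d\<^sup>2 = inner (x - x') (x' - x)"
    by (simp add: d_def power2_norm_eq_inner inner_diff_left inner_diff_right inner_commute)
  also have "\<dots> = l * (inner (gf x) (x' - x) + inner v (x' - x)
      + b * (inner w (x' - x) + inner (gh x) (x' - x)))"
    unfolding step by (simp add: inner_add_left algebra_simps)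
  also have "\<dots> \<ge> l * ((f x' - f x - Lf / 2 * d\<^sup>2) + p + b * (q + (h x' - h x - Lh / 2 * d\<^sup>2)))"
    using f.quadratic_upper_bound[of x' x] h.quadratic_upper_bound[of x' x] v w l b
    by (intro mult_left_mono add_mono) (auto simp: d_def)
  finally have "l * (f x' + p + b * (h x' + q) - (f x + b * h x))
      \<le> ((Lf * l + Lh * (l * b)) / 2 - 1) * d\<^sup>2"
    by (simp add: algebra_simps)
  also have "\<dots> \<le> 0" using small by (intro mult_nonpos_nonneg) auto
  finally show ?thesis using l by (simp add: mult_le_0_iff)
qed

section \<open>Asymptotic centers and weak convergence\<close>

text \<open>
By strong midpoint convexity, points with nearly minimal value are close to each other, so a
minimizer comes from completeness alone. The existence of projections and of asymptotic centers
are two instances.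
\<close>
lemma strongly_midconvex_attains_min:
  fixes \<phi> :: "'a::{real_inner, complete_space} \<Rightarrow> real"
  assumes K: "closed K" "convex K" "K \<noteq> {}"
    and nonneg: "\<And>y. 0 \<le> \<phi> y"
    and mid: "\<And>y z. \<phi> ((1/2) *\<^sub>R y + (1/2) *\<^sub>R z) \<le> (\<phi> y + \<phi> z) / 2 - (norm (y - z))\<^sup>2 / 4"
    and lsc: "\<And>c. closed {y. \<phi> y \<le> c}"
  obtains u where "u \<in> K" "\<And>y. y \<in> K \<Longrightarrow> \<phi> u + (norm (y - u))\<^sup>2 / 2 \<le> \<phi> y"
proof -
  \<comment> \<open>nested closed sets of approximate minimizers with diameter tending to \<open>0\<close>\<close>
  define m where "m = Inf (\<phi> ` K)"
  have bdd: "bdd_below (\<phi> ` K)" using nonneg by (auto intro!: bdd_belowI)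
  have m: "m \<le> \<phi> y" if "y \<in> K" for y
    unfolding m_def using that bdd by (intro cInf_lower) auto
  have midK: "(1/2) *\<^sub>R y + (1/2) *\<^sub>R z \<in> K" if "y \<in> K" "z \<in> K" for y z
    using convexD[OF K(2) that, of "1/2" "1/2"] by simp
  have close: "(norm (y - z))\<^sup>2 \<le> 4 * e"
    if "y \<in> K" "z \<in> K" "\<phi> y \<le> m + e" "\<phi> z \<le> m + e" for y z e
    using order_trans[OF m[OF midK[OF that(1,2)]] mid] that(3,4) by argo
  define N where "N = (\<lambda>n. K \<inter> {y. \<phi> y \<le> m + inverse (real (Suc n))})"
  have "closed (N n)" for n
    unfolding N_def using K lsc by auto
  moreover have "N n \<noteq> {}" for n
  proof -
    have "\<exists>y\<in>\<phi> ` K. y < m + inverse (real (Suc n))"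
      unfolding m_def using K bdd by (subst cInf_less_iff[symmetric]) auto
    then show ?thesis unfolding N_def using less_imp_le by blast
  qed
  moreover have "N n \<subseteq> N k" if "k \<le> n" for k n
    using that by (auto simp: N_def intro: order_trans le_imp_inverse_le)
  moreover have "\<exists>n. \<forall>y\<in>N n. \<forall>z\<in>N n. dist y z < e" if "e > 0" for e
  proof -
    obtain n where n: "inverse (real (Suc n)) < e\<^sup>2 / 4"
      using reals_Archimedean[of "e\<^sup>2 / 4"] \<open>e > 0\<close> by auto
    have "dist y z < e" if "y \<in> N n" "z \<in> N n" for y z
    proof -
      have "(norm (y - z))\<^sup>2 < e\<^sup>2"
        using close[of y z "inverse (real (Suc n))"] n that by (auto simp: N_def)
      then show ?thesis using \<open>e > 0\<close> by (simp add: dist_norm power2_less_imp_less)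
    qed
    then show ?thesis by blast
  qed
  ultimately obtain u where u: "\<And>n. u \<in> N n"
    using decreasing_closed_nest[of N] by metis
  have uK: "u \<in> K" using u by (auto simp: N_def)
  have "\<phi> u \<le> m"
  proof (rule field_le_epsilon)
    fix e :: real assume "e > 0"
    then obtain n where "inverse (real (Suc n)) < e" using reals_Archimedean by blast
    with u[of n] show "\<phi> u \<le> m + e" by (auto simp: N_def)
  qed
  moreover have "\<phi> u + (norm (y - u))\<^sup>2 / 2 \<le> \<phi> y" if "y \<in> K" for y
    using order_trans[OF m[OF midK[OF that uK]] mid] \<open>\<phi> u \<le> m\<close> by argo
  ultimately show thesis using that uK by blast
qed

lemma norm_diff_square: "(norm (a - b))\<^sup>2 = (norm a)\<^sup>2 + (norm b)\<^sup>2 - 2 * inner a b"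
  for a b :: "'a::real_inner"
  by (simp add: power2_norm_eq_inner inner_diff_left inner_diff_right inner_commute)

lemma norm_midpoint_square:
  "(norm (x - ((1/2) *\<^sub>R y + (1/2) *\<^sub>R z)))\<^sup>2
    = ((norm (x - y))\<^sup>2 + (norm (x - z))\<^sup>2) / 2 - (norm (y - z))\<^sup>2 / 4"
  for x y z :: "'a::real_inner"
proof -
  define a b where "a = x - y" and "b = x - z"
  have "2 *\<^sub>R (x - ((1/2) *\<^sub>R y + (1/2) *\<^sub>R z)) = a - - b"
    by (simp add: a_def b_def scaleR_right_diff_distrib scaleR_right_distrib scaleR_2)
  then have "(2 * norm (x - ((1/2) *\<^sub>R y + (1/2) *\<^sub>R z)))\<^sup>2 = (norm (a - - b))\<^sup>2"
    by (metis abs_numeral norm_scaleR)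
  then have "4 * (norm (x - ((1/2) *\<^sub>R y + (1/2) *\<^sub>R z)))\<^sup>2
      = (norm a)\<^sup>2 + (norm b)\<^sup>2 + 2 * inner a b"
    by (simp add: norm_diff_square[of a "- b", simplified] power_mult_distrib)
  moreover have "(norm (y - z))\<^sup>2 = (norm a)\<^sup>2 + (norm b)\<^sup>2 - 2 * inner a b"
    using norm_diff_square[of b a] by (simp add: a_def b_def inner_commute)
  ultimately show ?thesis unfolding a_def b_def by argo
qed

lemma closed_convex_projection:
  fixes K :: "'a::{real_inner, complete_space} set"
  assumes K: "closed K" "convex K" "K \<noteq> {}"
  obtains p where "p \<in> K" "\<And>y. y \<in> K \<Longrightarrow> (norm (y - p))\<^sup>2 + (norm (c - p))\<^sup>2 \<le> (norm (y - c))\<^sup>2"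
proof -
  let ?\<phi> = "\<lambda>y. (norm (c - y))\<^sup>2"
  have "closed {y. ?\<phi> y \<le> r}" for r
    by (intro closed_Collect_le continuous_intros)
  moreover have "?\<phi> ((1/2) *\<^sub>R y + (1/2) *\<^sub>R z) \<le> (?\<phi> y + ?\<phi> z) / 2 - (norm (y - z))\<^sup>2 / 4" for y z
    unfolding norm_midpoint_square by (rule order_refl)
  ultimately obtain p where p: "p \<in> K" "\<And>y. y \<in> K \<Longrightarrow> ?\<phi> p + (norm (y - p))\<^sup>2 / 2 \<le> ?\<phi> y"
    using strongly_midconvex_attains_min[where \<phi>="?\<phi>", OF K zero_le_power2] by blast
  have "dist c p \<le> dist c y" if "y \<in> K" for y
  proof -
    have "?\<phi> p \<le> ?\<phi> y" using p(2)[OF that] zero_le_power2[of "norm (y - p)"] by argo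
    then show ?thesis unfolding dist_norm by (rule power2_le_imp_le) simp
  qed
  then have obtuse: "inner (c - p) (y - p) \<le> 0" if "y \<in> K" for y
    using any_closest_point_dot[OF K(2,1) p(1) that] by blast
  show thesis
  proof (rule that[OF p(1)])
    fix y assume "y \<in> K"
    from obtuse[OF this] norm_diff_square[of "y - p" "c - p"]
    show "(norm (y - p))\<^sup>2 + (norm (c - p))\<^sup>2 \<le> (norm (y - c))\<^sup>2"
      by (simp add: inner_commute)
  qed
qed

text \<open>
For bounded \<open>x\<close>, the upper limit of \<open>\<parallel>x n - y\<parallel>\<^sup>2\<close> along the filter as a real number. A filter below \<^const>\<open>sequentially\<close>
takes the place of a subsequence.
\<close>
definition asymptotic_radius :: "nat filter \<Rightarrow> (nat \<Rightarrow> 'a::real_inner) \<Rightarrow> 'a \<Rightarrow> real" where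
  "asymptotic_radius G x y = Inf {r. eventually (\<lambda>n. (norm (x n - y))\<^sup>2 \<le> r) G}"

context
  fixes G :: "nat filter" and x :: "nat \<Rightarrow> 'a::{real_inner, complete_space}" and R :: real
  assumes G: "G \<noteq> bot" and bounded: "\<And>n. norm (x n) \<le> R"
begin

lemma asymptotic_radius_bound_nonneg:
  "eventually (\<lambda>n. (norm (x n - y))\<^sup>2 \<le> r) G \<Longrightarrow> 0 \<le> r"
  using eventually_happens'[OF G] order_trans[OF zero_le_power2] by blast

lemma asymptotic_radius_le:
  "eventually (\<lambda>n. (norm (x n - y))\<^sup>2 \<le> r) G \<Longrightarrow> asymptotic_radius G x y \<le> r"
  unfolding asymptotic_radius_def
  by (rule cInf_lower) (auto intro!: bdd_belowI[of _ 0] asymptotic_radius_bound_nonneg)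

lemma eventually_le_asymptotic_radius:
  assumes "asymptotic_radius G x y < r"
  shows "eventually (\<lambda>n. (norm (x n - y))\<^sup>2 \<le> r) G"
proof -
  let ?B = "{r. eventually (\<lambda>n. (norm (x n - y))\<^sup>2 \<le> r) G}"
  have "(norm (x n - y))\<^sup>2 \<le> (R + norm y)\<^sup>2" for n
    using norm_triangle_ineq4[of "x n" y] bounded[of n] by (intro power_mono) auto
  then have "(R + norm y)\<^sup>2 \<in> ?B" by simp
  then have "?B \<noteq> {}" by blast
  moreover have "bdd_below ?B"
    by (auto intro!: bdd_belowI[of _ 0] asymptotic_radius_bound_nonneg)
  ultimately obtain s where "s \<in> ?B" "s < r"
    using assms unfolding asymptotic_radius_def by (subst (asm) cInf_less_iff) auto
  then show ?thesis by (auto elim!: eventually_mono)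
qed

lemma asymptotic_radius_nonneg: "0 \<le> asymptotic_radius G x y"
proof (rule field_le_epsilon)
  fix e :: real assume "e > 0"
  then show "0 \<le> asymptotic_radius G x y + e"
    by (intro asymptotic_radius_bound_nonneg[of y] eventually_le_asymptotic_radius) simp
qed

lemma asymptotic_radius_eqI:
  assumes "((\<lambda>n. (norm (x n - y))\<^sup>2) \<longlongrightarrow> l) G"
  shows "asymptotic_radius G x y = l"
proof (rule antisym; rule field_le_epsilon)
  fix e :: real assume e: "e > 0"
  have "eventually (\<lambda>n. (norm (x n - y))\<^sup>2 < l + e) G"
    using order_tendstoD(2)[OF assms, of "l + e"] e by simp
  then show "asymptotic_radius G x y \<le> l + e"
    by (intro asymptotic_radius_le) (auto elim!: eventually_mono)
  show "l \<le> asymptotic_radius G x y + e"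
    using e by (intro tendsto_upperbound[OF assms _ G] eventually_le_asymptotic_radius) simp
qed

lemma asymptotic_radius_midpoint:
  "asymptotic_radius G x ((1/2) *\<^sub>R y + (1/2) *\<^sub>R z)
    \<le> (asymptotic_radius G x y + asymptotic_radius G x z) / 2 - (norm (y - z))\<^sup>2 / 4"
proof (rule field_le_epsilon)
  fix e :: real assume "e > 0"
  then have "eventually (\<lambda>n. (norm (x n - y))\<^sup>2 \<le> asymptotic_radius G x y + e) G"
    "eventually (\<lambda>n. (norm (x n - z))\<^sup>2 \<le> asymptotic_radius G x z + e) G"
    by (auto intro: eventually_le_asymptotic_radius)
  then show "asymptotic_radius G x ((1/2) *\<^sub>R y + (1/2) *\<^sub>R z)
      \<le> (asymptotic_radius G x y + asymptotic_radius G x z) / 2 - (norm (y - z))\<^sup>2 / 4 + e"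
  proof (intro asymptotic_radius_le, eventually_elim)
    case (elim n)
    then show ?case unfolding norm_midpoint_square by argo
  qed
qed

text \<open>
The parameter \<open>t\<close> trades the multiplicative against the additive error; letting first \<open>z \<rightarrow> y\<close> and then
\<open>t \<rightarrow> 0\<close> gives lower semicontinuity.
\<close>
lemma asymptotic_radius_perturb:
  assumes "0 < t"
  shows "asymptotic_radius G x y
    \<le> (1 + t) * asymptotic_radius G x z + (1 + 1 / t) * (norm (z - y))\<^sup>2"
proof (rule field_le_epsilon)
  fix e :: real assume "e > 0"
  have young: "(norm (a + b))\<^sup>2 \<le> (1 + t) * (norm a)\<^sup>2 + (1 + 1 / t) * (norm b)\<^sup>2" for a b :: 'a
  proof -
    have "2 * (norm a * norm b) \<le> t * (norm a)\<^sup>2 + (norm b)\<^sup>2 / t"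
      using zero_le_power2[of "t * norm a - norm b"] \<open>t > 0\<close>
      by (simp add: field_simps power2_eq_square)
    moreover have "(norm (a + b))\<^sup>2 \<le> (norm a + norm b)\<^sup>2"
      by (intro power_mono norm_triangle_ineq) simp
    ultimately show ?thesis by (simp add: power2_sum distrib_right)
  qed
  have "eventually (\<lambda>n. (norm (x n - z))\<^sup>2 \<le> asymptotic_radius G x z + e / (1 + t)) G"
    using \<open>e > 0\<close> \<open>t > 0\<close> by (intro eventually_le_asymptotic_radius) simp
  then show "asymptotic_radius G x y
      \<le> (1 + t) * asymptotic_radius G x z + (1 + 1 / t) * (norm (z - y))\<^sup>2 + e"
  proof (intro asymptotic_radius_le, eventually_elim)
    case (elim n)
    have "(norm (x n - y))\<^sup>2 \<le> (1 + t) * (norm (x n - z))\<^sup>2 + (1 + 1 / t) * (norm (z - y))\<^sup>2"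
      using young[of "x n - z" "z - y"] by simp
    moreover have "(1 + t) * (norm (x n - z))\<^sup>2 \<le> (1 + t) * (asymptotic_radius G x z + e / (1 + t))"
      using elim \<open>t > 0\<close> by (intro mult_left_mono) auto
    moreover have "(1 + t) * (asymptotic_radius G x z + e / (1 + t)) = (1 + t) * asymptotic_radius G x z + e"
      using \<open>t > 0\<close> by (simp add: field_simps)
    ultimately show ?case by linarith
  qed
qed

lemma closed_sublevel_asymptotic_radius: "closed {y. asymptotic_radius G x y \<le> c}"
proof (unfold closed_sequential_limits, intro allI impI, elim conjE)
  fix z y assume z: "\<forall>n. z n \<in> {y. asymptotic_radius G x y \<le> c}" and lim: "z \<longlonglongrightarrow> y"
  have *: "asymptotic_radius G x y \<le> (1 + t) * c" if "t > 0" for t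
  proof (rule LIMSEQ_le_const)
    show "(\<lambda>n. (1 + t) * c + (1 + 1 / t) * (norm (z n - y))\<^sup>2) \<longlonglongrightarrow> (1 + t) * c"
      using lim by (auto intro!: tendsto_eq_intros)
    have "asymptotic_radius G x y \<le> (1 + t) * c + (1 + 1 / t) * (norm (z n - y))\<^sup>2" for n
    proof -
      have "(1 + t) * asymptotic_radius G x (z n) \<le> (1 + t) * c"
        using z that by (intro mult_left_mono) auto
      then show ?thesis using asymptotic_radius_perturb[OF that, of y "z n"] by linarith
    qed
    then show "\<exists>N. \<forall>n\<ge>N. asymptotic_radius G x y \<le> (1 + t) * c + (1 + 1 / t) * (norm (z n - y))\<^sup>2"
      by blast
  qed
  have "((\<lambda>t. (1 + t) * c) \<longlongrightarrow> (1 + 0) * c) (at_right 0)"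
    by (intro tendsto_intros)
  then have "asymptotic_radius G x y \<le> (1 + 0) * c"
    by (rule tendsto_lowerbound) (auto intro!: eventually_mono[OF eventually_at_right_less] *)
  then show "y \<in> {y. asymptotic_radius G x y \<le> c}" by simp
qed

text \<open>
The center lies in \<open>K\<close> because replacing it by its projection onto \<open>K\<close> brings it closer to all points of \<open>K\<close>,
hence does not increase the radius, while the minimizer of the radius is unique.
\<close>
lemma asymptotic_center_exists:
  obtains u where
    "\<And>y. asymptotic_radius G x u + (norm (y - u))\<^sup>2 / 2 \<le> asymptotic_radius G x y"
    "\<And>K. closed K \<Longrightarrow> convex K \<Longrightarrow> eventually (\<lambda>n. x n \<in> K) G \<Longrightarrow> u \<in> K"
proof -
  obtain u where
    u: "\<And>y. asymptotic_radius G x u + (norm (y - u))\<^sup>2 / 2 \<le> asymptotic_radius G x y"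
  proof (rule strongly_midconvex_attains_min[OF closed_UNIV convex_UNIV UNIV_not_empty,
          of "asymptotic_radius G x"])
    fix u assume "\<And>y. y \<in> UNIV \<Longrightarrow>
      asymptotic_radius G x u + (norm (y - u))\<^sup>2 / 2 \<le> asymptotic_radius G x y"
    then show thesis by (intro that[of u]) simp
  qed (simp_all add: asymptotic_radius_nonneg asymptotic_radius_midpoint closed_sublevel_asymptotic_radius)
  moreover have "u \<in> K" if K: "closed K" "convex K" and ev: "eventually (\<lambda>n. x n \<in> K) G" for K
  proof -
    have "K \<noteq> {}" using eventually_happens'[OF G ev] by blast
    then obtain p where p: "p \<in> K"
      "\<And>y. y \<in> K \<Longrightarrow> (norm (y - p))\<^sup>2 + (norm (u - p))\<^sup>2 \<le> (norm (y - u))\<^sup>2"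
      using closed_convex_projection[OF K] by blast
    have "asymptotic_radius G x p \<le> asymptotic_radius G x u"
    proof (rule field_le_epsilon)
      fix e :: real assume "e > 0"
      then have "eventually (\<lambda>n. (norm (x n - u))\<^sup>2 \<le> asymptotic_radius G x u + e) G"
        by (intro eventually_le_asymptotic_radius) simp
      with ev show "asymptotic_radius G x p \<le> asymptotic_radius G x u + e"
      proof (intro asymptotic_radius_le, eventually_elim)
        case (elim n)
        then have xn: "x n \<in> K" "(norm (x n - u))\<^sup>2 \<le> asymptotic_radius G x u + e" by simp_all
        show ?case using p(2)[OF xn(1)] xn(2) zero_le_power2[of "norm (u - p)"] by linarith
      qed
    qed
    with u[of p] have "(norm (p - u))\<^sup>2 \<le> 0" by argo
    with p(1) show ?thesis by simp
  qed
  ultimately show thesis by (rule that)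
qed

end

lemma frequently_nontrivial_filter:
  assumes "\<exists>\<^sub>F n in F. P n"
  shows "inf F (principal {n. P n}) \<noteq> bot"
  using assms by (auto simp: trivial_limit_def eventually_inf_principal frequently_def elim: eventually_mono)

text \<open>
A form of Opial's lemma. The assumption \<open>demiclosed\<close> is used for the asymptotic center of \<open>x\<close> along an
arbitrary filter. On \<open>S\<close> the radius is the limit \<open>l\<close> of the squared distances, whatever the filter, so all
these centers are the unique minimizer of \<open>l\<close> on \<open>S\<close>. If \<open>x n - u\<close> had a component at least \<open>e\<close> in a
direction \<open>y\<close> infinitely often, moving \<open>u\<close> slightly in this direction would decrease the radius along
these indices.
\<close>
lemma quasi_fejer_weak_convergence:
  fixes x :: "nat \<Rightarrow> 'a::{real_inner, complete_space}"
  assumes bounded: "\<And>n. norm (x n) \<le> R"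
    and conv: "\<And>s. s \<in> S \<Longrightarrow> convergent (\<lambda>n. (norm (x n - s))\<^sup>2)"
    and demiclosed: "\<And>u. (\<And>K. closed K \<Longrightarrow> convex K \<Longrightarrow> eventually (\<lambda>n. x n \<in> K) sequentially \<Longrightarrow> u \<in> K)
      \<Longrightarrow> u \<in> S"
  obtains u where "u \<in> S" "weakly_converges x u"
proof -
  define l where "l s = lim (\<lambda>n. (norm (x n - s))\<^sup>2)" for s
  have l: "(\<lambda>n. (norm (x n - s))\<^sup>2) \<longlonglongrightarrow> l s" if "s \<in> S" for s
    using conv[OF that] by (simp add: l_def convergent_LIMSEQ_iff)
  have center: "\<exists>u\<in>S. (\<forall>s\<in>S. l u + (norm (s - u))\<^sup>2 / 2 \<le> l s) \<and>
      (\<forall>y. asymptotic_radius G x u \<le> asymptotic_radius G x y)"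
    if G: "G \<noteq> bot" "G \<le> sequentially" for G
  proof -
    obtain u where u: "\<And>y. asymptotic_radius G x u + (norm (y - u))\<^sup>2 / 2 \<le> asymptotic_radius G x y"
      "\<And>K. closed K \<Longrightarrow> convex K \<Longrightarrow> eventually (\<lambda>n. x n \<in> K) G \<Longrightarrow> u \<in> K"
      using asymptotic_center_exists[where G=G and x=x and R=R, OF G(1) bounded] by blast
    have "u \<in> S" by (rule demiclosed) (use u(2) filter_leD[OF G(2)] in blast)
    moreover have radius: "asymptotic_radius G x s = l s" if "s \<in> S" for s
      using asymptotic_radius_eqI[where G=G and x=x and R=R, OF G(1) bounded tendsto_mono[OF G(2) l[OF that]]] .
    have "l u + (norm (s - u))\<^sup>2 / 2 \<le> l s" if "s \<in> S" for s
      using u(1)[of s] by (simp add: radius that \<open>u \<in> S\<close>)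
    moreover have "asymptotic_radius G x u \<le> asymptotic_radius G x y" for y
      using u(1)[of y] zero_le_power2[of "norm (y - u)"] by linarith
    ultimately show ?thesis by blast
  qed
  obtain u where u: "u \<in> S" "\<And>s. s \<in> S \<Longrightarrow> l u + (norm (s - u))\<^sup>2 / 2 \<le> l s"
    using center[of sequentially] by auto
  have freq: False if "\<exists>\<^sub>F n in sequentially. e \<le> inner (x n - u) y" and e: "e > 0" for y e
  proof -
    define G where "G = inf sequentially (principal {n. e \<le> inner (x n - u) y})"
    have G: "G \<noteq> bot" "G \<le> sequentially"
      unfolding G_def using frequently_nontrivial_filter[OF that(1)] by auto
    obtain w where w: "w \<in> S" "\<And>s. s \<in> S \<Longrightarrow> l w + (norm (s - w))\<^sup>2 / 2 \<le> l s"
      "\<And>y. asymptotic_radius G x w \<le> asymptotic_radius G x y"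
      using center[OF G] by blast
    have "(norm (w - u))\<^sup>2 \<le> 0"
      using u(2)[OF w(1)] w(2)[OF u(1)] unfolding norm_minus_commute[of u w] by argo
    then have "w = u" by simp
    \<comment> \<open>a step so short that its quadratic cost stays below its linear gain \<open>2 * t * e\<close>\<close>
    define t where "t = e / (1 + (norm y)\<^sup>2)"
    have pos: "1 + (norm y)\<^sup>2 > 0" by (simp add: add_pos_nonneg)
    have t: "t > 0" using e pos by (simp add: t_def)
    have "t * (norm y)\<^sup>2 \<le> e"
      using e pos by (simp add: t_def field_simps)
    then have t2: "t\<^sup>2 * (norm y)\<^sup>2 \<le> t * e"
      using t by (simp add: power2_eq_square mult.assoc)
    have "asymptotic_radius G x (u + t *\<^sub>R y) \<le> asymptotic_radius G x u - t * e / 2"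
    proof (rule asymptotic_radius_le[where R=R, OF G(1) bounded])
      have "eventually (\<lambda>n. (norm (x n - u))\<^sup>2 \<le> asymptotic_radius G x u + t * e / 2) G"
        using t e by (intro eventually_le_asymptotic_radius[where R=R, OF G(1) bounded]) simp
      moreover have "eventually (\<lambda>n. e \<le> inner (x n - u) y) G"
        by (simp add: G_def eventually_inf_principal)
      ultimately show "eventually (\<lambda>n. (norm (x n - (u + t *\<^sub>R y)))\<^sup>2 \<le> asymptotic_radius G x u - t * e / 2) G"
      proof eventually_elim
        case (elim n)
        have "(norm (x n - (u + t *\<^sub>R y)))\<^sup>2
            = (norm (x n - u))\<^sup>2 - 2 * (t * inner (x n - u) y) + t\<^sup>2 * (norm y)\<^sup>2"
          using norm_diff_square[of "x n - u" "t *\<^sub>R y"]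
          by (simp add: diff_diff_eq power_mult_distrib)
        moreover have "t * e \<le> t * inner (x n - u) y" using elim t by simp
        ultimately show ?case using elim t2 by linarith
      qed
    qed
    moreover have "0 < t * e" using t e by simp
    ultimately show False using w(3)[of "u + t *\<^sub>R y"] \<open>w = u\<close> by simp
  qed
  have ev: "eventually (\<lambda>n. inner (x n - u) y < e) sequentially" if "e > 0" for y e
    using freq[OF _ that, of y] by (auto simp: frequently_def not_le)
  have "(\<lambda>n. inner (x n) y) \<longlonglongrightarrow> inner u y" for y
  proof (rule tendstoI)
    fix e :: real assume e: "e > 0"
    from ev[OF e, of y] ev[OF e, of "- y"]
    show "eventually (\<lambda>n. dist (inner (x n) y) (inner u y) < e) sequentially"
      by eventually_elim (auto simp: dist_real_def inner_diff_left)
  qed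
  then show thesis using that u(1) unfolding weakly_converges_def by blast
qed

section \<open>Recursive inequalities for real sequences\<close>

text \<open>
Subtracting the partial sums of the errors turns \<open>a\<close> into a decreasing sequence that is bounded below,
and \<open>s\<close> is dominated by its decrements.
\<close>
lemma quasi_fejer_summable:
  fixes a s e :: "nat \<Rightarrow> real"
  assumes step: "\<And>n. n \<ge> N \<Longrightarrow> a (Suc n) + s n \<le> a n + e n"
    and a: "\<And>n. 0 \<le> a n" and s: "\<And>n. n \<ge> N \<Longrightarrow> 0 \<le> s n"
    and e: "\<And>n. n \<ge> N \<Longrightarrow> 0 \<le> e n" "summable e"
  shows "convergent a" "summable s"
proof -
  define b where "b n = a (n + N) - (\<Sum>k<n. e (k + N))" for n
  have e': "summable (\<lambda>k. e (k + N))" using e(2) by (simp add: summable_iff_shift)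
  have diff: "s (n + N) \<le> b n - b (Suc n)" for n
    using step[of "n + N"] by (simp add: b_def)
  have dec: "decseq b"
    using diff s[of "_ + N"] by (intro decseq_SucI) (meson diff_ge_0_iff_ge le_add2 order_trans)
  have "- (\<Sum>k. e (k + N)) \<le> b n" for n
  proof -
    have "(\<Sum>k<n. e (k + N)) \<le> (\<Sum>k. e (k + N))"
      using e by (intro sum_le_suminf[OF e']) auto
    then show ?thesis using a[of "n + N"] by (simp add: b_def)
  qed
  then obtain l where l: "b \<longlonglongrightarrow> l" using decseq_convergent[OF dec] by blast
  have "(\<lambda>n. b n + (\<Sum>k<n. e (k + N))) \<longlonglongrightarrow> l + (\<Sum>k. e (k + N))"
    by (intro tendsto_intros l summable_LIMSEQ e')
  then have "(\<lambda>n. a (n + N)) \<longlonglongrightarrow> l + (\<Sum>k. e (k + N))" by (simp add: b_def)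
  then show "convergent a"
    unfolding convergent_def by (blast dest: LIMSEQ_offset)
  have "summable (\<lambda>n. b n - b (Suc n))"
    using telescope_summable'[OF l] by simp
  then have "summable (\<lambda>n. s (n + N))"
    using diff s[of "_ + N"] by (rule_tac summable_comparison_test[where g="\<lambda>n. b n - b (Suc n)"]) auto
  then show "summable s" by (simp add: summable_iff_shift)
qed

lemma discrete_gronwall:
  fixes H l r :: "nat \<Rightarrow> real"
  assumes step: "\<And>n. n \<ge> p \<Longrightarrow> H (Suc n) \<le> (1 + c * l n) * H n + r n"
    and nonneg: "\<And>n. 0 \<le> H n" "\<And>n. 0 \<le> l n" "\<And>n. 0 \<le> r n" "0 \<le> c"
    and "p \<le> n"
  shows "H n \<le> exp (c * sum l {p..<n}) * (H p + sum r {p..<n})"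
  using \<open>p \<le> n\<close>
proof (induction n rule: dec_induct)
  case base
  then show ?case by simp
next
  case (step n)
  let ?E = "exp (c * sum l {p..<n})"
  have pos: "0 \<le> sum l {p..<n}" "0 \<le> sum r {p..<n}" using nonneg by (auto intro: sum_nonneg)
  have "H (Suc n) \<le> (1 + c * l n) * H n + r n" using assms(1) step by simp
  also have "(1 + c * l n) * H n \<le> exp (c * l n) * (?E * (H p + sum r {p..<n}))"
    using step.IH nonneg by (intro mult_mono exp_ge_add_one_self) auto
  also have "r n \<le> exp (c * l n) * ?E * r n"
    using nonneg pos mult_right_mono[of 1 "exp (c * l n) * ?E" "r n"]
    by (simp add: exp_add[symmetric])
  finally have "H (Suc n) \<le> exp (c * l n) * ?E * (H p + sum r {p..<n} + r n)"
    by (simp add: algebra_simps)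
  also have "exp (c * l n) * ?E = exp (c * sum l {p..<Suc n})"
    using step by (simp add: exp_add[symmetric] algebra_simps)
  finally show ?case using step by (simp add: algebra_simps)
qed

lemma divergent_partial_sums:
  fixes l :: "nat \<Rightarrow> real"
  assumes "\<And>n. 0 \<le> l n" "\<not> summable l"
  shows "\<exists>n\<ge>M. B \<le> sum l {M..<n}"
proof (rule ccontr)
  assume *: "\<not> ?thesis"
  have "(\<Sum>i<n. l (i + M)) \<le> B" for n
  proof -
    have "sum l {M..<n + M} = (\<Sum>i<n. l (i + M))"
      using sum.shift_bounds_nat_ivl[of l 0 M n] by (simp add: atLeast0LessThan)
    then show ?thesis using * by (metis le_add2 linear)
  qed
  then have "summable (\<lambda>i. l (i + M))"
    using assms by (intro bounded_imp_summable[of _ B]) (auto simp: lessThan_Suc_atMost[symmetric] simp del: sum.lessThan_Suc)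
  then show False using assms by (simp add: summable_iff_shift)
qed

text \<open>
Go back from \<open>n\<close> to the last index \<open>m\<close> from which the steps \<open>l\<close> sum up to at least \<open>1\<close>. As the tail of
\<open>l n * H (Suc n)\<close> is small, \<open>H\<close> is small at some index between, and the steps from there to \<open>n\<close> sum up to at
most \<open>1\<close>, so that \<open>H\<close> has grown by at most the factor \<open>exp c\<close> since then. The last index is taken so that
a single long step, which may exceed \<open>1\<close> by far, only ever occurs at the start of such a stretch.
\<close>
lemma slow_growth_tendsto_zero:
  fixes H l r :: "nat \<Rightarrow> real"
  assumes step: "\<And>n. n \<ge> N \<Longrightarrow> H (Suc n) \<le> (1 + c * l n) * H n + r n"
    and nonneg: "\<And>n. 0 \<le> H n" "\<And>n. 0 \<le> l n" "\<And>n. 0 \<le> r n" "0 \<le> c"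
    and div: "\<not> summable l" and sH: "summable (\<lambda>n. l n * H (Suc n))" and sr: "summable r"
  shows "H \<longlonglongrightarrow> 0"
proof (rule LIMSEQ_I)
  fix \<delta> :: real assume "\<delta> > 0"
  define e where "e = \<delta> / (3 * exp c)"
  have e: "e > 0" using \<open>\<delta> > 0\<close> by (simp add: e_def)
  obtain M1 where M1: "\<And>m n. m \<ge> M1 \<Longrightarrow> norm (\<Sum>k=m..<n. l k * H (Suc k)) < e"
    using sH e unfolding summable_Cauchy by meson
  obtain M2 where M2: "\<And>m n. m \<ge> M2 \<Longrightarrow> norm (sum r {m..<n}) < e"
    using sr e unfolding summable_Cauchy by meson
  define M where "M = max N (max M1 M2)"
  obtain n0 where n0: "M \<le> n0" "1 \<le> sum l {M..<n0}"
    using divergent_partial_sums[OF nonneg(2) div] by blast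
  have "H n < \<delta>" if "n \<ge> n0" for n
  proof -
    have "sum l {M..<n0} \<le> sum l {M..<n}"
      using that nonneg by (intro sum_mono2) auto
    then have ex: "1 \<le> sum l {M..<n}" using n0 by linarith
    define P where "P m \<longleftrightarrow> m \<le> n \<and> 1 \<le> sum l {m..<n}" for m
    have PM: "P M" using ex n0 that by (simp add: P_def)
    define m where "m = (GREATEST m. P m)"
    have Pm: "P m" and Mm: "M \<le> m" and max: "\<And>k. P k \<Longrightarrow> k \<le> m"
      unfolding m_def
      using GreatestI_nat[of P M n] Greatest_le_nat[of P _ n] PM by (auto simp: P_def)
    have "\<exists>k\<in>{m..<n}. H (Suc k) \<le> e"
    proof (rule ccontr)
      assume "\<not> ?thesis"
      then have "sum l {m..<n} * e \<le> (\<Sum>k=m..<n. l k * H (Suc k))"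
        unfolding sum_distrib_right using nonneg by (intro sum_mono mult_left_mono) (auto simp: not_le less_imp_le)
      moreover have "e \<le> sum l {m..<n} * e"
        using Pm e mult_right_mono[of 1 "sum l {m..<n}" e] by (simp add: P_def)
      moreover have "\<bar>\<Sum>k=m..<n. l k * H (Suc k)\<bar> < e" using M1[of m n] Mm by (simp add: M_def)
      ultimately show False by linarith
    qed
    then obtain k where k: "m \<le> k" "k < n" "H (Suc k) \<le> e" by auto
    have "\<not> P (Suc m)" using max[of "Suc m"] by auto
    then have "sum l {Suc m..<n} \<le> 1" using k by (auto simp: P_def)
    moreover have "sum l {Suc k..<n} \<le> sum l {Suc m..<n}"
      using k nonneg by (intro sum_mono2) auto
    ultimately have short: "c * sum l {Suc k..<n} \<le> c"
      using nonneg(4) mult_left_mono[of "sum l {Suc k..<n}" 1 c] by simp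
    have "H n \<le> exp (c * sum l {Suc k..<n}) * (H (Suc k) + sum r {Suc k..<n})"
      using k Mm by (intro discrete_gronwall step nonneg) (auto simp: M_def)
    also have "\<dots> \<le> exp c * (e + e)"
      using short k(1,3) M2[of "Suc k" n] Mm nonneg
      by (intro mult_mono add_mono) (auto simp: M_def intro!: add_nonneg_nonneg sum_nonneg)
    also have "\<dots> < \<delta>" using \<open>\<delta> > 0\<close> by (simp add: e_def field_simps)
    finally show ?thesis .
  qed
  then show "\<exists>no. \<forall>n\<ge>no. norm (H n - 0) < \<delta>" using nonneg by auto
qed

text \<open>
If \<open>\<bar>a n\<bar>\<close> stayed away from \<open>0\<close>, the weights themselves would be summable.
\<close>
lemma weighted_summable_subsequence:
  fixes a l :: "nat \<Rightarrow> real"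
  assumes l: "\<And>n. 0 \<le> l n" "\<not> summable l" and s: "summable (\<lambda>n. l n * \<bar>a n\<bar>)"
  obtains r where "strict_mono r" "(\<lambda>n. a (r n)) \<longlonglongrightarrow> 0"
proof -
  have small: "\<exists>n>m. \<bar>a n\<bar> < e" if "e > 0" for m e
  proof (rule ccontr)
    assume "\<not> ?thesis"
    then have "\<bar>l n\<bar> \<le> inverse e * (l n * \<bar>a n\<bar>)" if "n > m" for n
      using that \<open>e > 0\<close> l(1)[of n] mult_left_mono[of e "\<bar>a n\<bar>" "l n"]
      by (force simp: field_simps not_less)
    then have "summable l"
      by (intro summable_comparison_test_ev[OF _ summable_mult[OF s]]
          eventually_mono[OF eventually_gt_at_top[of m]]) auto
    with l show False by blast
  qed
  have "\<exists>r. \<forall>n. \<bar>a (r n)\<bar> < inverse (real (Suc n)) \<and> r n < r (Suc n)"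
  proof (rule dependent_nat_choice)
    show "\<exists>k. \<bar>a k\<bar> < inverse (real (Suc 0))" using small[of 1 0] by auto
    show "\<exists>k'. \<bar>a k'\<bar> < inverse (real (Suc (Suc n))) \<and> k < k'" for k n
      using small[of "inverse (real (Suc (Suc n)))" k] by auto
  qed
  then obtain r where r: "\<And>n. \<bar>a (r n)\<bar> < inverse (real (Suc n))" "\<And>n. r n < r (Suc n)"
    by blast
  have "strict_mono r" using r(2) by (simp add: strict_mono_Suc_iff)
  moreover have "(\<lambda>n. a (r n)) \<longlonglongrightarrow> 0"
    by (rule Lim_null_comparison[OF _ LIMSEQ_inverse_real_of_nat])
      (use r(1) in \<open>auto intro!: always_eventually less_imp_le\<close>)
  ultimately show thesis using that by blast
qed

section \<open>Extended-valued convex functions\<close>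

lemma closed_sublevel_sum:
  fixes G :: "'a::real_normed_vector \<Rightarrow> ereal"
  assumes f: "continuous_on UNIV f" and G: "lsc_fun G"
  shows "closed {y. ereal (f y) + G y \<le> ereal c}"
proof -
  have "open {y. ereal c < ereal (f y) + G y}"
  proof (subst open_subopen, clarify)
    fix y assume "ereal c < ereal (f y) + G y"
    then have "ereal (c - f y) < G y" by (cases "G y") auto
    from ereal_dense2[OF this] obtain d where "ereal (c - f y) < ereal d" and dG: "ereal d < G y"
      by blast
    then have cd: "c - f y < d" by simp
    have "ereal d < Liminf (at y) G"
      using dG G unfolding lsc_fun_def by (blast intro: less_le_trans)
    then have "eventually (\<lambda>z. ereal d < G z) (nhds y)"
      unfolding eventually_nhds_conv_at using less_LiminfD dG by blast
    moreover have "continuous (at y) (\<lambda>z. c - f z)"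
      using f by (intro continuous_intros) (simp add: continuous_on_eq_continuous_at)
    then have "((\<lambda>z. c - f z) \<longlongrightarrow> c - f y) (at y)" by (simp add: isCont_def)
    then have "eventually (\<lambda>z. c - f z < d) (nhds y)"
      unfolding eventually_nhds_conv_at using order_tendstoD(2)[OF _ cd] cd by blast
    ultimately have "eventually (\<lambda>z. ereal c < ereal (f z) + G z) (nhds y)"
    proof eventually_elim
      case (elim z)
      then show ?case by (cases "G z") auto
    qed
    then show "\<exists>T. open T \<and> y \<in> T \<and> T \<subseteq> {y. ereal c < ereal (f y) + G y}"
      unfolding eventually_nhds by auto
  qed
  moreover have "- {y. ereal (f y) + G y \<le> ereal c} = {y. ereal c < ereal (f y) + G y}"
    by auto
  ultimately show ?thesis by (simp add: closed_def)
qed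

lemma convex_sublevel_sum:
  assumes f: "convex_on UNIV f" and G: "convex_fun G"
  shows "convex {y. ereal (f y) + G y \<le> ereal c}"
proof (rule convexI)
  fix y z and s t :: real
  assume y: "y \<in> {y. ereal (f y) + G y \<le> ereal c}" and z: "z \<in> {y. ereal (f y) + G y \<le> ereal c}"
    and st: "0 \<le> s" "0 \<le> t" "s + t = 1"
  show "s *\<^sub>R y + t *\<^sub>R z \<in> {y. ereal (f y) + G y \<le> ereal c}"
  proof (cases "t = 0 \<or> t = 1")
    case True
    then show ?thesis using y z st by auto
  next
    case False
    then have t: "0 < t" "t < 1" and s: "s = 1 - t" using st by auto
    let ?m = "(1 - t) *\<^sub>R y + t *\<^sub>R z"
    have yc: "G y \<le> ereal (c - f y)" using y by (cases "G y") auto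
    have zc: "G z \<le> ereal (c - f z)" using z by (cases "G z") auto
    have "G ?m \<le> ereal (1 - t) * G y + ereal t * G z"
      using G t unfolding convex_fun_def by blast
    also have "\<dots> \<le> ereal (1 - t) * ereal (c - f y) + ereal t * ereal (c - f z)"
      using yc zc t by (intro add_mono ereal_mult_left_mono) auto
    finally have "G ?m \<le> ereal (c - ((1 - t) * f y + t * f z))" by (simp add: algebra_simps)
    also have "\<dots> \<le> ereal (c - f ?m)"
      using convex_onD[OF f, of t y z] t by simp
    finally show ?thesis unfolding s by (cases "G ?m") auto
  qed
qed

lemma subdiff_real:
  assumes "v \<in> subdiff G y" "\<bar>G z\<bar> \<noteq> \<infinity>"
  shows "real_of_ereal (G y) - real_of_ereal (G z) \<le> inner v (y - z)"
proof -
  have "G y + ereal (inner v (z - y)) \<le> G z" "\<bar>G y\<bar> \<noteq> \<infinity>"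
    using assms(1) by (auto simp: subdiff_def)
  then show ?thesis using assms(2)
    by (cases "G y"; cases "G z") (auto simp: inner_diff_right)
qed

text \<open>
The operator \<open>T'\<close> below is the subdifferential of \<open>f + G\<close> restricted to \<open>C\<close>. It is monotone and extends \<open>T\<close>,
so maximality forces equality, and the zeros of \<open>T'\<close> are the minimizers. Maximality of \<open>T\<close> takes the part
of a qualification condition for the sum rule.
\<close>
lemma zeros_eq_constrained_minimizers:
  fixes G :: "'a::real_inner \<Rightarrow> ereal"
  assumes smooth: "smooth_convex f g L"
    and T: "T = (\<lambda>y. subdiff G y + {g y} + normal_cone C y)"
    and maximal: "maximal_monotone_op T"
  shows "{y. 0 \<in> T y} = {u \<in> C. \<bar>G u\<bar> \<noteq> \<infinity> \<and> (\<forall>y\<in>C. ereal (f u) + G u \<le> ereal (f y) + G y)}"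
proof -
  interpret smooth_convex f g L by (rule smooth)
  define T' where "T' y = {w. y \<in> C \<and> \<bar>G y\<bar> \<noteq> \<infinity> \<and>
      (\<forall>z\<in>C. ereal (f y) + G y + ereal (inner w (z - y)) \<le> ereal (f z) + G z)}" for y
  have "monotone_op T'"
    unfolding monotone_op_def
  proof (intro allI ballI)
    fix y z u v assume "u \<in> T' y" "v \<in> T' z"
    then have "ereal (f y) + G y + ereal (inner u (z - y)) \<le> ereal (f z) + G z"
      "ereal (f z) + G z + ereal (inner v (y - z)) \<le> ereal (f y) + G y"
      "\<bar>G y\<bar> \<noteq> \<infinity>" "\<bar>G z\<bar> \<noteq> \<infinity>"
      by (auto simp: T'_def)
    then have "inner u (z - y) + inner v (y - z) \<le> 0"
      by (cases "G y"; cases "G z") auto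
    then show "0 \<le> inner (u - v) (y - z)"
      by (simp add: inner_diff_left inner_diff_right)
  qed
  moreover have "T y \<subseteq> T' y" for y
  proof
    fix w assume "w \<in> T y"
    then obtain a n where w: "w = a + g y + n" and a: "a \<in> subdiff G y" and n: "n \<in> normal_cone C y"
      unfolding T by (auto elim!: set_plus_elim)
    have y: "y \<in> C" "\<bar>G y\<bar> \<noteq> \<infinity>" using a n by (auto simp: subdiff_def normal_cone_def split: if_splits)
    have "ereal (f y) + G y + ereal (inner w (z - y)) \<le> ereal (f z) + G z" if "z \<in> C" for z
    proof -
      have "inner n (z - y) \<le> 0" using n that y by (simp add: normal_cone_def)
      moreover have "G y + ereal (inner a (z - y)) \<le> G z" using a by (simp add: subdiff_def)
      ultimately show ?thesis using above_tangent[of y z] y(2)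
        by (cases "G y"; cases "G z") (auto simp: w inner_add_left)
    qed
    then show "w \<in> T' y" using y by (simp add: T'_def)
  qed
  ultimately have eq: "T' = T" using maximal unfolding maximal_monotone_op_def by blast
  then show ?thesis
    by (simp add: T'_def zero_ereal_def[symmetric] set_eq_iff flip: eq)
qed

text \<open>
For \<open>z\<close> normal to \<open>C\<close> at \<open>u\<close> the support function at \<open>z\<close> is \<open>inner z u\<close>, so the difference between the conjugate and
the support function is the least constant in Fenchel's inequality \<open>inner (z / b) (y - u) \<le> P y + constant\<close>.
These constants are nonnegative because \<open>P u = 0\<close>, and summability forces them to be finite.
\<close>
lemma summable_conjugate_gap_bound:
  fixes P :: "'a::real_inner \<Rightarrow> ereal" and l b :: "nat \<Rightarrow> real"
  assumes z: "z \<in> normal_cone C u" and Pu: "P u = 0"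
    and l: "\<And>n. 0 < l n" and b: "\<And>n. 0 < b n"
    and sum: "(\<Sum>n. ereal (l n * b n) *
        (fenchel_conj P (z /\<^sub>R b n) - support_fun C (z /\<^sub>R b n))) < \<infinity>"
  obtains e where "\<And>n. 0 \<le> e n" "summable (\<lambda>n. l n * e n)"
    "\<And>n y. ereal (inner z (y - u)) \<le> ereal (b n) * P y + ereal (e n)"
proof -
  let ?gap = "\<lambda>n. fenchel_conj P (z /\<^sub>R b n) - support_fun C (z /\<^sub>R b n)"
  have uC: "u \<in> C" and zC: "\<And>c. c \<in> C \<Longrightarrow> inner z c \<le> inner z u"
    using z by (auto simp: normal_cone_def inner_diff_right split: if_splits)
  have supp: "support_fun C (z /\<^sub>R b n) = ereal (inner z u / b n)" for n
    unfolding support_fun_def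
  proof (rule SUP_eqI)
    show "ereal (inner (z /\<^sub>R b n) c) \<le> ereal (inner z u / b n)" if "c \<in> C" for c
      using zC[OF that] b[of n] by (simp add: field_simps)
    show "ereal (inner z u / b n) \<le> y"
      if "\<And>i. i \<in> C \<Longrightarrow> ereal (inner (z /\<^sub>R b n) i) \<le> y" for y
      using that[OF uC] by (simp add: field_simps)
  qed
  have conj: "ereal (inner y z / b n) - P y \<le> fenchel_conj P (z /\<^sub>R b n)" for n y
    unfolding fenchel_conj_def by (rule SUP_upper2[of y]) (auto simp: field_simps)
  have gap: "0 \<le> ?gap n" for n
    using conj[of u n] Pu by (simp add: supp inner_commute ereal_diff_positive)
  then have "0 \<le> ereal (l n * b n) * ?gap n" for n
    using l[of n] b[of n] by simp
  from suminf_PInfty_fun[of "\<lambda>n. ereal (l n * b n) * ?gap n", OF this] sum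
  have "\<exists>t. (\<lambda>n. ereal (l n * b n) * ?gap n) = (\<lambda>n. ereal (t n))" by simp
  then obtain t where t: "\<And>n. ereal (l n * b n) * ?gap n = ereal (t n)"
    by (auto simp: fun_eq_iff)
  define e where "e n = t n / l n" for n
  have conj_eq: "fenchel_conj P (z /\<^sub>R b n) = ereal ((e n + inner z u) / b n)" for n
  proof (cases "fenchel_conj P (z /\<^sub>R b n)")
    case (real r)
    have "l n * b n * (r - inner z u / b n) = t n"
      using t[of n] unfolding supp real by simp
    moreover have "l n * b n * (r - inner z u / b n) = l n * (b n * r - inner z u)"
      using b[of n] by (simp add: right_diff_distrib)
    ultimately have "e n = b n * r - inner z u"
      using l[of n] by (simp add: e_def field_simps)
    then show ?thesis using b[of n] unfolding real by simp
  next
    case PInf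
    then show ?thesis using t[of n] l[of n] b[of n] unfolding supp PInf by simp
  next
    case MInf
    then show ?thesis using gap[of n] unfolding supp MInf by simp
  qed
  show thesis
  proof
    show "0 \<le> e n" for n
      using gap[of n] b[of n] unfolding conj_eq supp by (simp add: field_simps)
    have "summable t"
    proof (rule summable_ereal)
      show "0 \<le> t n" for n
        using \<open>0 \<le> ereal (l n * b n) * ?gap n\<close> unfolding t by simp
      show "(\<Sum>n. ereal (t n)) \<noteq> \<infinity>" using sum by (simp add: t)
    qed
    moreover have "l n * e n = t n" for n using l[of n] by (simp add: e_def)
    ultimately show "summable (\<lambda>n. l n * e n)" by simp
    show "ereal (inner z (y - u)) \<le> ereal (b n) * P y + ereal (e n)" for n y
    proof (cases "P y")
      case (real r)
      have "inner y z / b n - r \<le> (e n + inner z u) / b n"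
        using conj[of y n] unfolding conj_eq real by simp
      then have "(inner y z - (e n + inner z u)) / b n \<le> r" by (simp add: diff_divide_distrib)
      then have "inner y z - (e n + inner z u) \<le> r * b n" using b[of n] by (simp add: pos_divide_le_eq)
      then show ?thesis unfolding real
        by (simp add: inner_diff_right inner_commute[of y z] mult.commute)
    next
      case PInf
      then show ?thesis using b[of n] by simp
    next
      case MInf
      then show ?thesis using conj[of y n] unfolding conj_eq by simp
    qed
  qed
qed

section \<open>The penalty scheme\<close>

text \<open>
The data of the algorithm after unfolding: \<open>v n\<close> and \<open>w n\<close> are the subgradients chosen by the implicit
step, \<open>u0\<close> is a solution, and \<open>p\<close> is a normal vector whose negative is a subgradient of \<open>Phi + Phi2\<close> at \<open>u0\<close>.
\<close>
locale penalty_scheme =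
  Phi: smooth_convex Phi gPhi LPhi + Psi1: smooth_convex Psi1 gPsi1 LPsi1
  for Phi Psi1 :: "'a::{real_inner, complete_space} \<Rightarrow> real" and gPhi gPsi1 LPhi LPsi1 +
  fixes Phi2 Psi2 :: "'a \<Rightarrow> ereal" and C :: "'a set"
    and lam bet :: "nat \<Rightarrow> real" and x v w :: "nat \<Rightarrow> 'a" and u0 p :: 'a
  assumes Phi2_ne_MInf: "Phi2 y \<noteq> -\<infinity>" and Phi2_lsc: "lsc_fun Phi2" and Phi2_convex: "convex_fun Phi2"
    and Psi2_lsc: "lsc_fun Psi2" and Psi2_convex: "convex_fun Psi2"
    and Psi1_nonneg: "0 \<le> Psi1 y" and Psi2_nonneg: "0 \<le> Psi2 y"
    and C_eq: "C = {y. Psi1 y = 0 \<and> Psi2 y = 0}"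
    and lam_pos: "n \<ge> 1 \<Longrightarrow> 0 < lam n" and bet_pos: "n \<ge> 1 \<Longrightarrow> 0 < bet n"
    and v: "n \<ge> 1 \<Longrightarrow> v n \<in> subdiff Phi2 (x (Suc n))"
    and w: "n \<ge> 1 \<Longrightarrow> w n \<in> subdiff Psi2 (x (Suc n))"
    and step: "n \<ge> 1 \<Longrightarrow>
      x n - x (Suc n) = lam n *\<^sub>R (gPhi (x n) + v n + bet n *\<^sub>R (gPsi1 (x n) + w n))"
    and u0: "u0 \<in> C" "\<bar>Phi2 u0\<bar> \<noteq> \<infinity>"
    and p: "p \<in> normal_cone C u0"
    and p_subgradient: "\<bar>Phi2 y\<bar> \<noteq> \<infinity> \<Longrightarrow>
      Phi u0 + real_of_ereal (Phi2 u0) - inner p (y - u0) \<le> Phi y + real_of_ereal (Phi2 y)"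
    and conjugate_gap: "z \<in> normal_cone C u0 \<Longrightarrow>
      (\<Sum>n. ereal (lam (Suc n) * bet (Suc n)) *
         (fenchel_conj (\<lambda>y. ereal (Psi1 y) + Psi2 y) (z /\<^sub>R bet (Suc n))
            - support_fun C (z /\<^sub>R bet (Suc n)))) < \<infinity>"
    and lam_div: "\<not> summable lam"
    and lam_sq: "summable (\<lambda>n. LPhi * (lam n)\<^sup>2)"
    and limsup_step: "limsup (\<lambda>n. ereal (LPsi1 * lam n * bet n)) < 2"
begin

abbreviation F :: "'a \<Rightarrow> ereal" where "F y \<equiv> ereal (Phi y) + Phi2 y"
abbreviation Psi :: "'a \<Rightarrow> ereal" where "Psi y \<equiv> ereal (Psi1 y) + Psi2 y"

definition minimizers :: "'a set" where
  "minimizers = {u \<in> C. \<bar>Phi2 u\<bar> \<noteq> \<infinity> \<and> (\<forall>y\<in>C. F u \<le> F y)}"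

text \<open>
The real-valued \<open>gap\<close> and \<open>pen\<close> agree with the extended values of \<open>F - F u0\<close> and \<open>Psi\<close> at the iterates only from
index \<open>2\<close> on, since the starting point may lie outside the domains.
\<close>
definition gap :: "nat \<Rightarrow> real" where
  "gap n = Phi (x n) + real_of_ereal (Phi2 (x n)) - (Phi u0 + real_of_ereal (Phi2 u0))"

definition pen :: "nat \<Rightarrow> real" where
  "pen n = Psi1 (x n) + real_of_ereal (Psi2 (x n))"

lemma finite_iterates:
  assumes "n \<ge> 2"
  shows "\<bar>Phi2 (x n)\<bar> \<noteq> \<infinity>" "\<bar>Psi2 (x n)\<bar> \<noteq> \<infinity>"
proof -
  obtain k where k: "n = Suc k" "k \<ge> 1" using assms by (cases n) auto
  then show "\<bar>Phi2 (x n)\<bar> \<noteq> \<infinity>" "\<bar>Psi2 (x n)\<bar> \<noteq> \<infinity>"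
    using v[of k] w[of k] by (auto simp: subdiff_def)
qed

lemma F_iterate: "n \<ge> 2 \<Longrightarrow> F (x n) = ereal (gap n + (Phi u0 + real_of_ereal (Phi2 u0)))"
  using finite_iterates(1)[of n] by (auto simp: gap_def)

lemma Psi_iterate: "n \<ge> 2 \<Longrightarrow> Psi (x n) = ereal (pen n)"
  using finite_iterates(2)[of n] by (auto simp: pen_def)

lemma F_u0: "F u0 = ereal (Phi u0 + real_of_ereal (Phi2 u0))"
  using u0(2) by auto

lemma pen_nonneg: "0 \<le> pen n"
  using Psi1_nonneg Psi2_nonneg by (simp add: pen_def real_of_ereal_pos)

lemma mem_C: "y \<in> C \<longleftrightarrow> Psi1 y = 0 \<and> Psi2 y = 0"
  by (simp add: C_eq)

lemma u0_minimal:
  assumes "y \<in> C"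
  shows "F u0 \<le> F y"
proof (cases "Phi2 y")
  case (real r)
  have "inner p (y - u0) \<le> 0" using p assms by (simp add: normal_cone_def split: if_splits)
  then show ?thesis using p_subgradient[of y] real F_u0 by auto
qed (use Phi2_ne_MInf[of y] in auto)

lemma mem_C_iff_Psi_nonpos: "y \<in> C \<longleftrightarrow> Psi y \<le> 0"
  using Psi1_nonneg[of y] Psi2_nonneg[of y] unfolding C_eq
  by (cases "Psi2 y") auto

lemma minimizersI:
  assumes "y \<in> C" "F y \<le> F u0"
  shows "y \<in> minimizers"
proof -
  have "\<bar>Phi2 y\<bar> \<noteq> \<infinity>" using assms(2) Phi2_ne_MInf[of y] F_u0 by (cases "Phi2 y") auto
  then show ?thesis
    using assms u0_minimal order_trans unfolding minimizers_def by blast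
qed

lemma u0_minimizer: "u0 \<in> minimizers"
  using u0(1) by (intro minimizersI) auto

lemma minimizer_value:
  assumes "u \<in> minimizers"
  shows "Phi u + real_of_ereal (Phi2 u) = Phi u0 + real_of_ereal (Phi2 u0)"
proof -
  have "F u \<le> F u0" "F u0 \<le> F u" "\<bar>Phi2 u\<bar> \<noteq> \<infinity>"
    using assms u0_minimal u0(1) by (auto simp: minimizers_def)
  then show ?thesis using F_u0 by (cases "Phi2 u") auto
qed

lemma gap_lower: "n \<ge> 2 \<Longrightarrow> - inner p (x n - u0) \<le> gap n"
  using p_subgradient[OF finite_iterates(1)[of n]] by (simp add: gap_def)

text \<open>
The penalty at step \<open>n\<close> compensates how far an iterate \<open>x m\<close> violates the constraint in the direction \<open>p\<close>.
The indices are independent because the penalty parameters \<open>bet (m - 1)\<close> and \<open>bet m\<close> both meet \<open>x m\<close>.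
\<close>
lemma penalty_dominates_normal:
  assumes t: "0 < t"
  obtains e where "\<And>n. 0 \<le> e n" "summable (\<lambda>n. lam n * e n)"
    "\<And>m n. m \<ge> 2 \<Longrightarrow> n \<ge> 1 \<Longrightarrow> t * inner p (x m - u0) \<le> bet n * pen m + e n"
proof -
  have z: "t *\<^sub>R p \<in> normal_cone C u0"
    using p t by (auto simp: normal_cone_def mult_le_0_iff split: if_splits)
  have Psi0: "Psi u0 = 0" using u0(1) by (simp add: C_eq)
  have pos: "0 < lam (Suc n)" "0 < bet (Suc n)" for n using lam_pos bet_pos by simp_all
  obtain e where e: "\<And>n. 0 \<le> e n" "summable (\<lambda>n. lam (Suc n) * e n)"
    "\<And>n y. ereal (inner (t *\<^sub>R p) (y - u0)) \<le> ereal (bet (Suc n)) * Psi y + ereal (e n)"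
    by (rule summable_conjugate_gap_bound[OF z Psi0 pos conjugate_gap[OF z]]) (rule that; assumption)
  show thesis
    \<comment> \<open>the series of the hypothesis starts at the parameters with index \<open>1\<close>\<close>
  proof (rule that[of "\<lambda>n. e (n - 1)"])
    show "0 \<le> e (n - 1)" for n by (rule e)
    show "summable (\<lambda>n. lam n * e (n - 1))"
      by (subst summable_Suc_iff[symmetric]) (use e(2) in simp)
    show "t * inner p (x m - u0) \<le> bet n * pen m + e (n - 1)" if "m \<ge> 2" "n \<ge> 1" for m n
      using e(3)[of "x m" "n - 1"] that by (simp add: Psi_iterate)
  qed
qed

lemma eventually_small_steps:
  obtains \<theta> N where "0 < \<theta>" "N \<ge> 2" "\<And>n. n \<ge> N \<Longrightarrow> LPhi * lam n \<le> \<theta>"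
    "\<And>n. n \<ge> N \<Longrightarrow> LPsi1 * (lam n * bet n) + 5 * \<theta> \<le> 2"
proof -
  obtain r :: real where r: "limsup (\<lambda>n. ereal (LPsi1 * lam n * bet n)) < ereal r" "r < 2"
    using ereal_dense2[OF limsup_step] by auto
  define \<theta> where "\<theta> = (2 - r) / 5"
  have \<theta>: "\<theta> > 0" using r(2) by (simp add: \<theta>_def)
  have "eventually (\<lambda>n. ereal (LPsi1 * lam n * bet n) < ereal r) sequentially"
    by (rule Limsup_lessD[OF r(1)])
  moreover have "eventually (\<lambda>n. LPhi * lam n < \<theta>) sequentially"
  proof (cases "LPhi = 0")
    case False
    then have "summable (\<lambda>n. (lam n)\<^sup>2)" using lam_sq by simp
    then have "(\<lambda>n. (lam n)\<^sup>2) \<longlonglongrightarrow> 0" by (rule summable_LIMSEQ_zero)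
    then have "(\<lambda>n. sqrt ((lam n)\<^sup>2)) \<longlonglongrightarrow> sqrt 0" by (intro tendsto_intros)
    then have "lam \<longlonglongrightarrow> 0" by (simp add: tendsto_rabs_zero_iff)
    then have "(\<lambda>n. LPhi * lam n) \<longlonglongrightarrow> LPhi * 0" by (intro tendsto_intros)
    then show ?thesis using order_tendstoD(2)[of _ 0 sequentially \<theta>] \<theta> by simp
  qed (use \<theta> in simp)
  ultimately have "eventually (\<lambda>n. LPhi * lam n \<le> \<theta> \<and> LPsi1 * (lam n * bet n) + 5 * \<theta> \<le> 2) sequentially"
  proof eventually_elim
    case (elim n)
    then have "LPsi1 * (lam n * bet n) < r" by (simp add: mult.assoc)
    moreover have "5 * \<theta> = 2 - r" by (simp add: \<theta>_def)
    ultimately show ?case using elim(2) by linarith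
  qed
  then obtain N where "\<And>n. n \<ge> N \<Longrightarrow> LPhi * lam n \<le> \<theta> \<and> LPsi1 * (lam n * bet n) + 5 * \<theta> \<le> 2"
    unfolding eventually_sequentially by blast
  then show thesis using that[of \<theta> "max N 2"] \<theta> by auto
qed

lemma fejer_step:
  assumes u: "u \<in> minimizers" and n: "n \<ge> 1"
    and \<theta>: "0 < \<theta>" "LPhi * lam n \<le> \<theta>" "LPsi1 * (lam n * bet n) + 5 * \<theta> \<le> 2"
  shows "(norm (x (Suc n) - u))\<^sup>2 + \<theta> * (lam n * bet n) * pen (Suc n) + 2 * lam n * gap (Suc n)
      \<le> (norm (x n - u))\<^sup>2"
proof -
  have uC: "Psi1 u = 0" "Psi2 u = 0" "\<bar>Phi2 u\<bar> \<noteq> \<infinity>"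
    using u by (auto simp: minimizers_def mem_C)
  have "(norm (x (Suc n) - u))\<^sup>2
      + \<theta> * (lam n * bet n) * (Psi1 (x (Suc n)) - Psi1 u + real_of_ereal (Psi2 (x (Suc n))))
      + 2 * lam n * (Phi (x (Suc n)) - Phi u + (real_of_ereal (Phi2 (x (Suc n))) - real_of_ereal (Phi2 u)))
      \<le> (norm (x n - u))\<^sup>2"
  proof (rule forward_backward_penalty_step[OF Phi.smooth_convex_axioms Psi1.smooth_convex_axioms
        _ lam_pos[OF n] bet_pos[OF n] step[OF n]])
    show "Psi1 u \<le> Psi1 y" for y using uC Psi1_nonneg by simp
    show "real_of_ereal (Phi2 (x (Suc n))) - real_of_ereal (Phi2 u) \<le> inner (v n) (x (Suc n) - u)"
      by (rule subdiff_real[OF v[OF n] uC(3)])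
    show "real_of_ereal (Psi2 (x (Suc n))) \<le> inner (w n) (x (Suc n) - u)"
      using subdiff_real[OF w[OF n], of u] uC(2) by simp
    show "0 \<le> real_of_ereal (Psi2 (x (Suc n)))" using Psi2_nonneg by (simp add: real_of_ereal_pos)
  qed (use \<theta> in auto)
  moreover have "Phi (x (Suc n)) - Phi u
      + (real_of_ereal (Phi2 (x (Suc n))) - real_of_ereal (Phi2 u)) = gap (Suc n)"
    using minimizer_value[OF u] unfolding gap_def by linarith
  ultimately show ?thesis using uC(1) by (simp add: pen_def)
qed

text \<open>
With \<open>t = 4 / \<theta>\<close> in \<open>penalty_dominates_normal\<close>, a possibly negative \<open>gap\<close> consumes only half of the penalty
term of \<open>fejer_step\<close>; the dissipation \<open>s\<close> below is then nonnegative up to a summable error, and bounds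
from above both the penalty and the absolute value of the gap.
\<close>
lemma energy_estimate:
  assumes u: "u \<in> minimizers"
  shows "convergent (\<lambda>n. (norm (x n - u))\<^sup>2)"
    and "summable (\<lambda>n. lam n * bet n * pen (Suc n))"
    and "summable (\<lambda>n. lam n * \<bar>gap (Suc n)\<bar>)"
proof -
  obtain \<theta> N where \<theta>: "0 < \<theta>" and N: "N \<ge> 2" and small: "\<And>n. n \<ge> N \<Longrightarrow> LPhi * lam n \<le> \<theta>"
    "\<And>n. n \<ge> N \<Longrightarrow> LPsi1 * (lam n * bet n) + 5 * \<theta> \<le> 2"
    by (rule eventually_small_steps) blast
  obtain e where e: "\<And>n. 0 \<le> e n" "summable (\<lambda>n. lam n * e n)"
    "\<And>m n. m \<ge> 2 \<Longrightarrow> n \<ge> 1 \<Longrightarrow> 4 / \<theta> * inner p (x m - u0) \<le> bet n * pen m + e n"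
    by (rule penalty_dominates_normal[of "4 / \<theta>"]) (use \<theta> in auto)
  define s where "s n = \<theta> * (lam n * bet n * pen (Suc n)) + 2 * (lam n * gap (Suc n))
      + \<theta> / 2 * (lam n * e n)" for n
  have lower: "\<theta> / 2 * (lam n * bet n * pen (Suc n)) \<le> s n" if "n \<ge> N" for n
  proof -
    have n: "n \<ge> 1" "Suc n \<ge> 2" using that N by auto
    have "4 * inner p (x (Suc n) - u0) \<le> \<theta> * (bet n * pen (Suc n) + e n)"
      using e(3)[OF n(2,1)] \<theta> by (simp add: field_simps)
    then have "0 \<le> 4 * gap (Suc n) + \<theta> * (bet n * pen (Suc n) + e n)"
      using gap_lower[OF n(2)] by linarith
    then have "0 \<le> lam n * (4 * gap (Suc n) + \<theta> * (bet n * pen (Suc n) + e n))"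
      using lam_pos[OF n(1)] by simp
    then show ?thesis by (simp add: s_def algebra_simps)
  qed
  have prod: "0 \<le> lam n * bet n * pen (Suc n)" "0 \<le> lam n * e n" if "n \<ge> N" for n
    using that N lam_pos[of n] bet_pos[of n] pen_nonneg e(1) by (simp_all add: less_imp_le)
  have s0: "0 \<le> s n" if "n \<ge> N" for n
    using lower[OF that] mult_nonneg_nonneg[OF _ prod(1)[OF that], of "\<theta> / 2"] \<theta> by linarith
  have stepN: "(norm (x (Suc n) - u))\<^sup>2 + s n \<le> (norm (x n - u))\<^sup>2 + \<theta> / 2 * (lam n * e n)"
    if "n \<ge> N" for n
    using fejer_step[OF u _ \<theta> small[OF that]] that N by (simp add: s_def algebra_simps)
  have e': "summable (\<lambda>n. \<theta> / 2 * (lam n * e n))" by (intro summable_mult e(2))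
  have e0: "0 \<le> \<theta> / 2 * (lam n * e n)" if "n \<ge> N" for n
    using \<theta> prod(2)[OF that] by simp
  note fejer = quasi_fejer_summable[where a="\<lambda>n. (norm (x n - u))\<^sup>2" and s=s and N=N,
      OF stepN zero_le_power2 s0 e0 e']
  show "convergent (\<lambda>n. (norm (x n - u))\<^sup>2)" by (rule fejer(1))
  show sp: "summable (\<lambda>n. lam n * bet n * pen (Suc n))"
  proof (rule summable_comparison_test)
    show "summable (\<lambda>n. 2 / \<theta> * s n)" by (intro summable_mult fejer(2))
    show "\<exists>N. \<forall>n\<ge>N. norm (lam n * bet n * pen (Suc n)) \<le> 2 / \<theta> * s n"
      using lower prod(1) \<theta> by (intro exI[of _ N]) (simp add: field_simps abs_of_nonneg)
  qed
  show "summable (\<lambda>n. lam n * \<bar>gap (Suc n)\<bar>)"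
  proof (rule summable_comparison_test)
    show "summable (\<lambda>n. s n + \<theta> * (lam n * bet n * pen (Suc n)) + \<theta> / 2 * (lam n * e n))"
      by (intro summable_add summable_mult fejer(2) sp e(2))
    show "\<exists>N. \<forall>n\<ge>N. norm (lam n * \<bar>gap (Suc n)\<bar>)
        \<le> s n + \<theta> * (lam n * bet n * pen (Suc n)) + \<theta> / 2 * (lam n * e n)"
    proof (intro exI[of _ N] allI impI)
      fix n assume n: "n \<ge> N"
      define a where "a = lam n * gap (Suc n)"
      have "norm (lam n * \<bar>gap (Suc n)\<bar>) = \<bar>a\<bar>" by (simp add: a_def abs_mult)
      moreover have "2 * a = s n - \<theta> * (lam n * bet n * pen (Suc n)) - \<theta> / 2 * (lam n * e n)"
        by (simp add: s_def a_def)
      moreover have "0 \<le> \<theta> * (lam n * bet n * pen (Suc n))" using prod(1)[OF n] \<theta> by simp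
      ultimately show "norm (lam n * \<bar>gap (Suc n)\<bar>)
          \<le> s n + \<theta> * (lam n * bet n * pen (Suc n)) + \<theta> / 2 * (lam n * e n)"
        using s0[OF n] e0[OF n] by linarith
    qed
  qed
qed

lemma iterates_bounded:
  obtains R where "0 \<le> R" "\<And>n. norm (x n) \<le> R"
proof -
  have "Bseq (\<lambda>n. (norm (x n - u0))\<^sup>2)"
    by (intro convergent_imp_Bseq energy_estimate(1) u0_minimizer)
  then obtain B where B: "\<And>n. (norm (x n - u0))\<^sup>2 \<le> B"
    unfolding Bseq_def by auto
  have R: "norm (x n) \<le> norm u0 + sqrt B" for n
  proof -
    have "norm (x n - u0) \<le> sqrt B" using B[of n] by (simp add: real_le_rsqrt)
    then show ?thesis using norm_triangle_ineq[of u0 "x n - u0"] by simp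
  qed
  have "0 \<le> norm u0 + sqrt B" by (rule order_trans[OF norm_ge_zero R])
  then show thesis using R by (rule that)
qed

lemma pen_tendsto_zero:
  assumes "liminf (\<lambda>n. ereal (lam n * bet n)) > 0"
  shows "pen \<longlonglongrightarrow> 0"
proof -
  obtain c :: real where c: "0 < c" "ereal c < liminf (\<lambda>n. ereal (lam n * bet n))"
    using ereal_dense2[OF assms] by auto
  have "eventually (\<lambda>n. ereal c < ereal (lam n * bet n)) sequentially"
    by (rule less_LiminfD[OF c(2)])
  then have ev: "eventually (\<lambda>n. norm (pen (Suc n)) \<le> 1 / c * (lam n * bet n * pen (Suc n))) sequentially"
  proof eventually_elim
    case (elim n)
    then have "c * pen (Suc n) \<le> lam n * bet n * pen (Suc n)"
      using pen_nonneg by (intro mult_right_mono) auto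
    then show ?case using c(1) pen_nonneg[of "Suc n"] by (simp add: field_simps)
  qed
  have "(\<lambda>n. 1 / c * (lam n * bet n * pen (Suc n))) \<longlonglongrightarrow> 1 / c * 0"
    by (intro tendsto_mult tendsto_const summable_LIMSEQ_zero energy_estimate(2)[OF u0_minimizer])
  then have "(\<lambda>n. pen (Suc n)) \<longlonglongrightarrow> 0"
    using Lim_null_comparison[OF ev] by simp
  then show ?thesis by (rule LIMSEQ_imp_Suc)
qed

lemma sublevels:
  "closed {y. F y \<le> ereal c}" "convex {y. F y \<le> ereal c}"
  "closed {y. Psi y \<le> ereal c}" "convex {y. Psi y \<le> ereal c}"
  using closed_sublevel_sum[OF Phi.continuous Phi2_lsc] convex_sublevel_sum[OF Phi.convex Phi2_convex]
    closed_sublevel_sum[OF Psi1.continuous Psi2_lsc] convex_sublevel_sum[OF Psi1.convex Psi2_convex]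
  by auto

lemma eventually_Psi_le:
  assumes "pen \<longlonglongrightarrow> 0" "0 < e"
  shows "eventually (\<lambda>n. x n \<in> {y. Psi y \<le> ereal e}) sequentially"
  using order_tendstoD(2)[OF assms] eventually_ge_at_top[of 2]
  by eventually_elim (simp add: Psi_iterate)

lemma mem_C_if_small:
  assumes "\<And>e. 0 < e \<Longrightarrow> Psi y \<le> ereal e"
  shows "y \<in> C"
  unfolding mem_C_iff_Psi_nonpos by (rule ereal_le_epsilon2) (use assms in simp)

lemma minimizer_if_small:
  assumes "\<And>e. 0 < e \<Longrightarrow> Psi y \<le> ereal e"
    and "\<And>e. 0 < e \<Longrightarrow> F y \<le> ereal (e + (Phi u0 + real_of_ereal (Phi2 u0)))"
  shows "y \<in> minimizers"
proof (rule minimizersI[OF mem_C_if_small[OF assms(1)]])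
  show "F y \<le> F u0"
    unfolding F_u0 by (rule ereal_le_epsilon2) (use assms(2) in \<open>simp add: add.commute\<close>)
qed

text \<open>
A subsequence along which the gap tends to \<open>0\<close> stays in a bounded sublevel set of \<open>F\<close> as well as of \<open>Psi\<close>,
so compactness of either gives a strong cluster point.
\<close>
lemma strong_convergence:
  assumes pen: "pen \<longlonglongrightarrow> 0"
    and compact: "boundedly_inf_compact F \<or> boundedly_inf_compact Psi"
  obtains u where "u \<in> minimizers" "x \<longlonglongrightarrow> u"
proof -
  let ?c = "Phi u0 + real_of_ereal (Phi2 u0)"
  obtain R where R: "0 \<le> R" "\<And>n. norm (x n) \<le> R" by (rule iterates_bounded) blast
  obtain r' where r': "strict_mono r'" "(\<lambda>n. gap (Suc (Suc (r' n)))) \<longlonglongrightarrow> 0"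
  proof (rule weighted_summable_subsequence[of "\<lambda>n. lam (Suc n)" "\<lambda>n. gap (Suc (Suc n))"])
    show "0 \<le> lam (Suc n)" for n using lam_pos[of "Suc n"] by simp
    show "\<not> summable (\<lambda>n. lam (Suc n))" using lam_div by (simp add: summable_Suc_iff)
    show "summable (\<lambda>n. lam (Suc n) * \<bar>gap (Suc (Suc n))\<bar>)"
      using energy_estimate(3)[OF u0_minimizer] by (subst summable_Suc_iff)
  qed blast
  define r where "r n = Suc (Suc (r' n))" for n
  have r: "strict_mono r" "(\<lambda>n. gap (r n)) \<longlonglongrightarrow> 0" "\<And>n. r n \<ge> 2"
    using r' by (auto simp: r_def strict_mono_def)
  have penr: "(\<lambda>n. pen (r n)) \<longlonglongrightarrow> 0"
    using LIMSEQ_subseq_LIMSEQ[OF pen r(1)] by (simp add: o_def)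
  obtain B where B: "\<And>n. gap (r n) \<le> B" "\<And>n. pen (r n) \<le> B"
  proof -
    obtain B1 where B1: "\<And>n. norm (gap (r n)) \<le> B1"
      using convergent_imp_Bseq[OF convergentI[OF r(2)]] by (auto simp: Bseq_def)
    obtain B2 where B2: "\<And>n. norm (pen (r n)) \<le> B2"
      using convergent_imp_Bseq[OF convergentI[OF penr]] by (auto simp: Bseq_def)
    show thesis
    proof (rule that[of "max B1 B2"])
      show "gap (r n) \<le> max B1 B2" "pen (r n) \<le> max B1 B2" for n
        using B1[of n] B2[of n] by auto
    qed
  qed
  define Q where "Q = (if boundedly_inf_compact F
      then closure {y. norm y \<le> R \<and> F y \<le> ereal (B + ?c)}
      else closure {y. norm y \<le> R \<and> Psi y \<le> ereal B})"
  have "compact Q" using compact R(1) by (auto simp: Q_def boundedly_inf_compact_def)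
  moreover have xQ: "x (r n) \<in> Q" for n
  proof -
    have "x (r n) \<in> {y. norm y \<le> R \<and> F y \<le> ereal (B + ?c)}"
      "x (r n) \<in> {y. norm y \<le> R \<and> Psi y \<le> ereal B}"
      using R(2) B by (simp_all add: F_iterate[OF r(3)] Psi_iterate[OF r(3)])
    then show ?thesis
      unfolding Q_def by (auto simp del: mem_Collect_eq intro: subsetD[OF closure_subset])
  qed
  ultimately have "\<exists>u\<in>Q. \<exists>s. strict_mono s \<and> ((\<lambda>n. x (r n)) \<circ> s) \<longlonglongrightarrow> u"
    unfolding compact_def by (elim allE[of _ "\<lambda>n. x (r n)"]) simp
  then obtain u s where s: "strict_mono s" and "((\<lambda>n. x (r n)) \<circ> s) \<longlonglongrightarrow> u"
    by blast
  then have lim: "(\<lambda>n. x (r (s n))) \<longlonglongrightarrow> u" by (simp add: o_def)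
  have "u \<in> minimizers"
  proof (rule minimizer_if_small)
    fix e :: real assume e: "0 < e"
    have "eventually (\<lambda>n. pen (r (s n)) < e) sequentially"
      using order_tendstoD(2)[OF LIMSEQ_subseq_LIMSEQ[OF penr s] e] by (simp add: o_def)
    then have "eventually (\<lambda>n. x (r (s n)) \<in> {y. Psi y \<le> ereal e}) sequentially"
      by (rule eventually_mono) (simp add: Psi_iterate[OF r(3)])
    moreover have "eventually (\<lambda>n. gap (r (s n)) < e) sequentially"
      using order_tendstoD(2)[OF LIMSEQ_subseq_LIMSEQ[OF r(2) s] e] by (simp add: o_def)
    then have "eventually (\<lambda>n. x (r (s n)) \<in> {y. F y \<le> ereal (e + ?c)}) sequentially"
      by (rule eventually_mono) (simp add: F_iterate[OF r(3)])
    ultimately show "Psi u \<le> ereal e" "F u \<le> ereal (e + ?c)"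
      using Lim_in_closed_set[OF sublevels(3) _ sequentially_bot lim, of e]
        Lim_in_closed_set[OF sublevels(1) _ sequentially_bot lim, of "e + ?c"]
      by simp_all
  qed
  moreover have "x \<longlonglongrightarrow> u"
  proof -
    obtain l where l: "(\<lambda>n. (norm (x n - u))\<^sup>2) \<longlonglongrightarrow> l"
      using energy_estimate(1)[OF \<open>u \<in> minimizers\<close>] unfolding convergent_def by blast
    have "(\<lambda>n. (norm (x (r (s n)) - u))\<^sup>2) \<longlonglongrightarrow> l"
      using LIMSEQ_subseq_LIMSEQ[OF LIMSEQ_subseq_LIMSEQ[OF l r(1)] s] by (simp add: o_def)
    moreover have "(\<lambda>n. (norm (x (r (s n)) - u))\<^sup>2) \<longlonglongrightarrow> (norm (u - u))\<^sup>2"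
      by (intro tendsto_intros lim)
    ultimately have "l = (norm (u - u))\<^sup>2" by (rule LIMSEQ_unique)
    then have "l = 0" by simp
    with l have "(\<lambda>n. sqrt ((norm (x n - u))\<^sup>2)) \<longlonglongrightarrow> sqrt 0" by (intro tendsto_intros) simp
    then show ?thesis by (simp add: tendsto_norm_zero_iff LIM_zero_iff)
  qed
  ultimately show thesis by (rule that)
qed

lemma weak_convergence:
  assumes pen: "pen \<longlonglongrightarrow> 0"
    and gap: "\<And>e. 0 < e \<Longrightarrow> eventually (\<lambda>n. gap n \<le> e) sequentially"
  obtains u where "u \<in> minimizers" "weakly_converges x u"
proof -
  obtain R where R: "\<And>n. norm (x n) \<le> R" by (rule iterates_bounded) blast
  show thesis
  proof (rule quasi_fejer_weak_convergence[OF R energy_estimate(1), of minimizers])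
    fix u assume u: "\<And>K. closed K \<Longrightarrow> convex K \<Longrightarrow> eventually (\<lambda>n. x n \<in> K) sequentially \<Longrightarrow> u \<in> K"
    show "u \<in> minimizers"
    proof (rule minimizer_if_small)
      fix e :: real assume e: "0 < e"
      show "Psi u \<le> ereal e"
        using u[OF sublevels(3,4) eventually_Psi_le[OF pen e]] by simp
      have "eventually (\<lambda>n. x n \<in> {y. F y \<le> ereal (e + (Phi u0 + real_of_ereal (Phi2 u0)))}) sequentially"
        using gap[OF e] eventually_ge_at_top[of 2]
        by eventually_elim (simp add: F_iterate)
      then show "F u \<le> ereal (e + (Phi u0 + real_of_ereal (Phi2 u0)))"
        using u[OF sublevels(1,2)] by simp
    qed
  qed (use that in blast)+
qed

text \<open>
If the gap were at most \<open>a < 0\<close> infinitely often, the asymptotic center along these indices would be a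
point of \<open>C\<close> with a value below the minimum.
\<close>
lemma gap_tendsto_zero:
  assumes pen: "pen \<longlonglongrightarrow> 0"
    and gap: "\<And>e. 0 < e \<Longrightarrow> eventually (\<lambda>n. gap n \<le> e) sequentially"
  shows "gap \<longlonglongrightarrow> 0"
proof (rule order_tendstoI)
  fix a :: real assume "0 < a"
  then show "eventually (\<lambda>n. gap n < a) sequentially"
    using gap[of "a / 2"] by (auto elim!: eventually_mono)
next
  fix a :: real assume a: "a < 0"
  let ?c = "Phi u0 + real_of_ereal (Phi2 u0)"
  obtain R where R: "\<And>n. norm (x n) \<le> R" by (rule iterates_bounded) blast
  show "eventually (\<lambda>n. a < gap n) sequentially"
  proof (rule ccontr)
    assume "\<not> ?thesis"
    then have freq: "\<exists>\<^sub>F n in sequentially. gap n \<le> a" by (simp add: frequently_def not_le)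
    define G where "G = inf sequentially (principal {n. gap n \<le> a})"
    have G: "G \<noteq> bot" "G \<le> sequentially"
      unfolding G_def using frequently_nontrivial_filter[OF freq] by auto
    obtain u where u: "\<And>K. closed K \<Longrightarrow> convex K \<Longrightarrow> eventually (\<lambda>n. x n \<in> K) G \<Longrightarrow> u \<in> K"
      by (rule asymptotic_center_exists[where x=x, OF G(1) R]) (rule that)
    have "u \<in> C"
    proof (rule mem_C_if_small)
      fix e :: real assume "0 < e"
      then show "Psi u \<le> ereal e"
        using u[OF sublevels(3,4) filter_leD[OF G(2) eventually_Psi_le[OF pen]]] by simp
    qed
    have "eventually (\<lambda>n. x n \<in> {y. F y \<le> ereal (a + ?c)}) G"
      unfolding G_def eventually_inf_principal
      using eventually_ge_at_top[of 2] by eventually_elim (simp add: F_iterate)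
    then have "F u \<le> ereal (a + ?c)" using u[OF sublevels(1,2)] by simp
    then have "ereal ?c \<le> ereal (a + ?c)"
      using u0_minimal[OF \<open>u \<in> C\<close>] unfolding F_u0 by (rule order_trans[rotated])
    then show False using a by simp
  qed
qed

lemma penalized_descent:
  obtains N where "N \<ge> 2"
    "\<And>n. n \<ge> N \<Longrightarrow> gap (Suc n) + bet n * pen (Suc n) \<le> gap n + bet n * pen n"
proof -
  obtain \<theta> N where \<theta>: "0 < \<theta>" and N: "N \<ge> 2" and small: "\<And>n. n \<ge> N \<Longrightarrow> LPhi * lam n \<le> \<theta>"
    "\<And>n. n \<ge> N \<Longrightarrow> LPsi1 * (lam n * bet n) + 5 * \<theta> \<le> 2"
    by (rule eventually_small_steps) blast
  have "gap (Suc n) + bet n * pen (Suc n) \<le> gap n + bet n * pen n" if "n \<ge> N" for n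
  proof -
    have n: "n \<ge> 1" "n \<ge> 2" using that N by auto
    have "Phi (x (Suc n)) + (real_of_ereal (Phi2 (x (Suc n))) - real_of_ereal (Phi2 (x n)))
        + bet n * (Psi1 (x (Suc n)) + (real_of_ereal (Psi2 (x (Suc n))) - real_of_ereal (Psi2 (x n))))
        \<le> Phi (x n) + bet n * Psi1 (x n)"
    proof (rule forward_backward_penalty_descent[OF Phi.smooth_convex_axioms
          Psi1.smooth_convex_axioms lam_pos[OF n(1)] bet_pos[OF n(1)] step[OF n(1)]])
      show "real_of_ereal (Phi2 (x (Suc n))) - real_of_ereal (Phi2 (x n)) \<le> inner (v n) (x (Suc n) - x n)"
        by (rule subdiff_real[OF v[OF n(1)] finite_iterates(1)[OF n(2)]])
      show "real_of_ereal (Psi2 (x (Suc n))) - real_of_ereal (Psi2 (x n)) \<le> inner (w n) (x (Suc n) - x n)"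
        by (rule subdiff_real[OF w[OF n(1)] finite_iterates(2)[OF n(2)]])
      show "LPhi * lam n + LPsi1 * (lam n * bet n) \<le> 2"
        using small[OF that] \<theta> by linarith
    qed
    then show ?thesis by (simp add: gap_def pen_def algebra_simps)
  qed
  with N show thesis by (rule that)
qed

text \<open>
The sequence \<open>H\<close> is the positive part of the objective penalized with the parameter that produced the
iterate. Passing to the next parameter costs \<open>(bet (Suc n) - bet n) * pen (Suc n)\<close>. If \<open>K * lam (Suc n) \<le> 1 / 2\<close>,
the growth condition bounds this by a multiple of \<open>lam (Suc n) * bet n * pen (Suc n)\<close>, and the penalty term
itself is at most \<open>2 * H n\<close> up to an error, because a negative gap can only cancel half of it. Longer
steps need no recursion: for them \<open>H (Suc n) \<le> 2 * K * lam (Suc n) * H (Suc n)\<close>, which is summable. The growth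
condition is stated with the factor \<open>pen (Suc n)\<close> so that it also holds when there is no penalty.
\<close>
lemma limsup_gap_nonpos:
  assumes K: "0 < K"
    and growth: "\<And>n. n \<ge> 1 \<Longrightarrow>
      (bet (Suc n) - bet n) * pen (Suc n) \<le> K * lam (Suc n) * bet (Suc n) * pen (Suc n)"
    and e: "0 < e"
  shows "eventually (\<lambda>n. gap n \<le> e) sequentially"
proof -
  define H where "H n = max (gap (Suc n) + bet n * pen (Suc n)) 0" for n
  obtain N where N: "N \<ge> 2" and descent:
    "\<And>n. n \<ge> N \<Longrightarrow> gap (Suc n) + bet n * pen (Suc n) \<le> gap n + bet n * pen n"
    by (rule penalized_descent) blast
  obtain d where d: "\<And>n. 0 \<le> d n" "summable (\<lambda>n. lam n * d n)"
    "\<And>m n. m \<ge> 2 \<Longrightarrow> n \<ge> 1 \<Longrightarrow> 4 * inner p (x m - u0) \<le> bet n * pen m + d n"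
    by (rule penalty_dominates_normal[of 4]) auto
  have H0: "0 \<le> H n" for n by (simp add: H_def)
  have lam0: "0 \<le> lam (Suc n)" for n using lam_pos[of "Suc n"] by simp
  have sH: "summable (\<lambda>n. lam n * H n)"
  proof (rule summable_comparison_test)
    show "summable (\<lambda>n. lam n * \<bar>gap (Suc n)\<bar> + lam n * bet n * pen (Suc n))"
      by (intro summable_add energy_estimate[OF u0_minimizer])
    show "\<exists>N. \<forall>n\<ge>N. norm (lam n * H n) \<le> lam n * \<bar>gap (Suc n)\<bar> + lam n * bet n * pen (Suc n)"
    proof (intro exI[of _ 1] allI impI)
      fix n :: nat assume n: "n \<ge> 1"
      have "H n \<le> \<bar>gap (Suc n)\<bar> + bet n * pen (Suc n)"
        using bet_pos[OF n] pen_nonneg[of "Suc n"] by (simp add: H_def)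
      then have "lam n * H n \<le> lam n * (\<bar>gap (Suc n)\<bar> + bet n * pen (Suc n))"
        using lam_pos[OF n] by (intro mult_left_mono) auto
      then show "norm (lam n * H n) \<le> lam n * \<bar>gap (Suc n)\<bar> + lam n * bet n * pen (Suc n)"
        using lam_pos[OF n] H0[of n] by (simp add: algebra_simps)
    qed
  qed
  have "H \<longlonglongrightarrow> 0"
  proof (rule slow_growth_tendsto_zero[where l="\<lambda>n. lam (Suc n)" and c="4 * K" and N=N and
        r="\<lambda>n. K * (lam (Suc n) * d (Suc n)) + 2 * K * (lam (Suc n) * H (Suc n))"])
    fix n assume "n \<ge> N"
    define m where "m = Suc n"
    have n: "n \<ge> 1" and m: "m \<ge> 2" "m \<ge> 1" "m \<ge> N" using \<open>n \<ge> N\<close> N by (auto simp: m_def)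
    define D where "D = bet n * pen m"
    define E where "E = bet m * pen m"
    define k where "k = K * lam m"
    have nn: "0 \<le> D" "0 \<le> E" "0 \<le> k" "0 \<le> H n" "0 \<le> H m" "0 \<le> d m"
      using bet_pos[OF n] bet_pos[OF m(2)] lam_pos[OF m(2)] K pen_nonneg H0 d(1)
      by (simp_all add: D_def E_def k_def)
    have "H m \<le> (1 + 4 * k) * H n + k * d m + 2 * k * H m"
    proof (cases "2 * k \<le> 1")
      case True
      have ED: "E - D \<le> k * E"
        using growth[OF n] by (simp add: D_def E_def k_def m_def algebra_simps)
      moreover have kE: "2 * k * E \<le> E" using mult_right_mono[OF True nn(2)] by simp
      ultimately have E2: "E \<le> 2 * D" by linarith
      have "- (E + d m) \<le> 4 * gap m"
        using d(3)[OF m(1,2)] gap_lower[OF m(1)] by (simp add: E_def)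
      moreover have Hn: "gap m + D \<le> H n" by (simp add: H_def D_def m_def)
      ultimately have D2: "D \<le> 2 * H n + d m / 2" using E2 by linarith
      have "k * E \<le> 2 * k * D" using mult_left_mono[OF E2 nn(3)] by (simp add: algebra_simps)
      also have "\<dots> \<le> 2 * k * (2 * H n + d m / 2)" using nn(3) D2 by (intro mult_left_mono) auto
      finally have "k * E \<le> 4 * k * H n + k * d m" by (simp add: algebra_simps)
      moreover have "gap (Suc m) + bet m * pen (Suc m) \<le> gap m + E"
        using descent[OF m(3)] by (simp add: E_def)
      ultimately have "gap (Suc m) + bet m * pen (Suc m) \<le> H n + (4 * k * H n + k * d m)"
        using ED Hn by linarith
      moreover have "0 \<le> 4 * k * H n" "0 \<le> k * d m" using nn by simp_all
      ultimately have "H m \<le> H n + (4 * k * H n + k * d m)"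
        using nn by (simp add: H_def[of m])
      moreover have "0 \<le> 2 * k * H m" using nn by simp
      ultimately show ?thesis by (simp add: algebra_simps)
    next
      case False
      then have "H m \<le> 2 * k * H m" using mult_right_mono[of 1 "2 * k" "H m"] nn by simp
      moreover have "0 \<le> (1 + 4 * k) * H n" "0 \<le> k * d m" using nn by simp_all
      ultimately show ?thesis by linarith
    qed
    then show "H (Suc n) \<le> (1 + 4 * K * lam (Suc n)) * H n
        + (K * (lam (Suc n) * d (Suc n)) + 2 * K * (lam (Suc n) * H (Suc n)))"
      by (simp add: k_def m_def mult.assoc add.assoc)
  next
    show "summable (\<lambda>n. lam (Suc n) * H (Suc n))" using sH by (subst summable_Suc_iff)
    show "summable (\<lambda>n. K * (lam (Suc n) * d (Suc n)) + 2 * K * (lam (Suc n) * H (Suc n)))"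
      using sH d(2) by (intro summable_add summable_mult; subst summable_Suc_iff)
    show "\<not> summable (\<lambda>n. lam (Suc n))" using lam_div by (simp add: summable_Suc_iff)
  qed (use K lam0 H0 d(1) in \<open>auto intro!: add_nonneg_nonneg mult_nonneg_nonneg\<close>)
  then have "eventually (\<lambda>n. H n < e) sequentially" using e by (rule order_tendstoD)
  then have "eventually (\<lambda>n. gap (Suc n) \<le> e) sequentially"
    using eventually_ge_at_top[of 1]
  proof eventually_elim
    case (elim n)
    have "0 \<le> bet n * pen (Suc n)" using bet_pos[OF elim(2)] pen_nonneg by simp
    moreover have "gap (Suc n) + bet n * pen (Suc n) \<le> H n" by (simp add: H_def)
    ultimately show ?case using elim(1) by linarith
  qed
  then show ?thesis by (subst (asm) eventually_sequentially_Suc)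
qed

end

section \<open>Convergence of the algorithm\<close>

theorem theorem3:
  fixes Phi Psi1 :: "'a::{real_inner, complete_space} \<Rightarrow> real"
    and gPhi gPsi1 :: "'a \<Rightarrow> 'a"
    and Phi2 Psi2 :: "'a \<Rightarrow> ereal"
    and lam bet :: "nat \<Rightarrow> real"
    and LPhi LPsi1 :: real
    and x :: "nat \<Rightarrow> 'a"
    and C S :: "'a set"
    and A T :: "'a \<Rightarrow> 'a set"
    and case_i case_ii case_iii :: bool
  defines "C \<equiv> argmin_set Psi1 \<inter> argmin_set Psi2"
    and "A \<equiv> subdiff Phi2"
    and "T \<equiv> (\<lambda>y. A y + {gPhi y} + normal_cone C y)"
    and "S \<equiv> {y. 0 \<in> T y}"
    and "case_i \<equiv> liminf (\<lambda>n. ereal (lam n * bet n)) > 0 \<and>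
      (boundedly_inf_compact (\<lambda>y. ereal (Phi y) + Phi2 y) \<or>
       boundedly_inf_compact (\<lambda>y. ereal (Psi1 y) + Psi2 y))"
    and "case_ii \<equiv> liminf (\<lambda>n. ereal (lam n * bet n)) > 0 \<and>
      bounded (lam ` {1..}) \<and>
      (\<exists>K>0. \<forall>n\<ge>1. bet (n + 1) - bet n \<le> K * lam (n + 1) * bet (n + 1))"
    and "case_iii \<equiv> Psi1 = (\<lambda>_. 0) \<and> Psi2 = (\<lambda>_. 0)"
  assumes "convex_on UNIV Phi" and "\<And>y. GDERIV Phi y :> gPhi y"
    and "convex_on UNIV Psi1" and "\<And>y. GDERIV Psi1 y :> gPsi1 y"
    and "proper_fun Phi2" and "lsc_fun Phi2" and "convex_fun Phi2"
    and "proper_fun Psi2" and "lsc_fun Psi2" and "convex_fun Psi2"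
    and "is_min_on Psi1 UNIV 0" and "is_min_on Psi2 UNIV 0"
    and "C \<noteq> {}"
    and "\<And>n. n \<ge> 1 \<Longrightarrow> lam n > 0" and "\<And>n. n \<ge> 1 \<Longrightarrow> bet n > 0"
    and a: "maximal_monotone_op T" "S \<noteq> {}"
    and b: "LPhi-lipschitz_on UNIV gPhi" "LPsi1-lipschitz_on UNIV gPsi1"
    and c: "\<And>z. z \<in> (\<Union>y. normal_cone C y) \<Longrightarrow>
      (\<Sum>n. ereal (lam (Suc n) * bet (Suc n)) *
         (fenchel_conj (\<lambda>y. ereal (Psi1 y) + Psi2 y) (z /\<^sub>R bet (Suc n))
            - support_fun C (z /\<^sub>R bet (Suc n)))) < \<infinity>"
    and d: "(\<Sum>n. ereal (lam (Suc n))) = \<infinity>"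
      "summable (\<lambda>n. LPhi * (lam (Suc n))\<^sup>2)"
      "limsup (\<lambda>n. ereal (LPsi1 * lam n * bet n)) < 2"
    and "case_i \<or> case_ii \<or> case_iii"
    and "SFBP A gPhi gPsi1 Psi2 lam bet x"
  shows "\<exists>xbar\<in>S. weakly_converges x xbar \<and>
      (case_i \<and> boundedly_inf_compact (\<lambda>y. ereal (Psi1 y) + Psi2 y) \<longrightarrow> x \<longlonglongrightarrow> xbar) \<and>
      (case_ii \<or> case_iii \<longrightarrow>
        (\<exists>m. is_min_on (\<lambda>y. ereal (Phi y) + Phi2 y) C m \<and>
          (\<lambda>n. ereal (Phi (x n)) + Phi2 (x n)) \<longlonglongrightarrow> m))"
proof -
  note minPsi1 = \<open>is_min_on Psi1 UNIV 0\<close> and minPsi2 = \<open>is_min_on Psi2 UNIV 0\<close>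
  have smooth: "smooth_convex Phi gPhi LPhi" "smooth_convex Psi1 gPsi1 LPsi1"
    using \<open>convex_on UNIV Phi\<close> \<open>\<And>y. GDERIV Phi y :> gPhi y\<close> b(1)
      \<open>convex_on UNIV Psi1\<close> \<open>\<And>y. GDERIV Psi1 y :> gPsi1 y\<close> b(2)
    by (unfold_locales)
  have nonneg: "0 \<le> Psi1 y" "0 \<le> Psi2 y" for y
    using minPsi1 minPsi2 by (simp_all add: is_min_on_def)
  have C_eq: "C = {y. Psi1 y = 0 \<and> Psi2 y = 0}"
  proof -
    have "argmin_set Psi1 = {y. Psi1 y = 0}" "argmin_set Psi2 = {y. Psi2 y = 0}"
      using minPsi1 minPsi2 by (auto simp: argmin_set_def is_min_on_def intro: antisym) (metis antisym)+
    then show ?thesis by (auto simp: C_def)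
  qed
  have S_eq: "S = {u \<in> C. \<bar>Phi2 u\<bar> \<noteq> \<infinity> \<and> (\<forall>y\<in>C. ereal (Phi u) + Phi2 u \<le> ereal (Phi y) + Phi2 y)}"
    unfolding S_def using a(1)
    by (intro zeros_eq_constrained_minimizers[OF smooth(1)]) (auto simp: T_def A_def)
  obtain u0 where "u0 \<in> S" using a(2) by blast
  then obtain a0 p where sum0: "a0 + gPhi u0 + p = 0" and a0: "a0 \<in> subdiff Phi2 u0"
    and p: "p \<in> normal_cone C u0"
    by (auto simp: S_def T_def A_def elim!: set_plus_elim)
  have "\<exists>v w. v \<in> subdiff Phi2 (x (Suc n)) \<and> w \<in> subdiff Psi2 (x (Suc n)) \<and>
      x n - x (Suc n) = lam n *\<^sub>R (gPhi (x n) + v + bet n *\<^sub>R (gPsi1 (x n) + w))" if n: "n \<ge> 1" for n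
  proof -
    from \<open>SFBP A gPhi gPsi1 Psi2 lam bet x\<close> n
    obtain v w where vw: "v \<in> subdiff Phi2 (x (Suc n))" "w \<in> subdiff Psi2 (x (Suc n))"
      "(x n - x (Suc n)) /\<^sub>R lam n - gPhi (x n) - bet n *\<^sub>R gPsi1 (x n) = v + bet n *\<^sub>R w"
      unfolding SFBP_def A_def by (auto elim!: set_plus_elim)
    have "lam n > 0" using n \<open>\<And>n. n \<ge> 1 \<Longrightarrow> lam n > 0\<close> by blast
    then have "x n - x (Suc n) = lam n *\<^sub>R ((x n - x (Suc n)) /\<^sub>R lam n)" by simp
    also have "(x n - x (Suc n)) /\<^sub>R lam n = gPhi (x n) + v + bet n *\<^sub>R (gPsi1 (x n) + w)"
      using vw(3) by (simp add: algebra_simps)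
    finally show ?thesis using vw(1,2) by blast
  qed
  then obtain v w where vw: "\<And>n. n \<ge> 1 \<Longrightarrow> v n \<in> subdiff Phi2 (x (Suc n))"
    "\<And>n. n \<ge> 1 \<Longrightarrow> w n \<in> subdiff Psi2 (x (Suc n))"
    "\<And>n. n \<ge> 1 \<Longrightarrow> x n - x (Suc n) = lam n *\<^sub>R (gPhi (x n) + v n + bet n *\<^sub>R (gPsi1 (x n) + w n))"
    by metis
  interpret penalty_scheme Phi Psi1 gPhi gPsi1 LPhi LPsi1 Phi2 Psi2 C lam bet x v w u0 p
  proof (intro penalty_scheme.intro smooth penalty_scheme_axioms.intro)
    show "Phi2 y \<noteq> -\<infinity>" for y using \<open>proper_fun Phi2\<close> by (simp add: proper_fun_def)
    show "u0 \<in> C" "\<bar>Phi2 u0\<bar> \<noteq> \<infinity>" using \<open>u0 \<in> S\<close> by (auto simp: S_eq)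
    show "Phi u0 + real_of_ereal (Phi2 u0) - inner p (y - u0) \<le> Phi y + real_of_ereal (Phi2 y)"
      if "\<bar>Phi2 y\<bar> \<noteq> \<infinity>" for y
    proof -
      have "a0 + gPhi u0 = - p" using sum0 by (simp add: eq_neg_iff_add_eq_0)
      then have "inner a0 (y - u0) + inner (gPhi u0) (y - u0) = - inner p (y - u0)"
        by (metis inner_add_left inner_minus_left)
      moreover have "real_of_ereal (Phi2 u0) - real_of_ereal (Phi2 y) \<le> inner a0 (u0 - y)"
        by (rule subdiff_real[OF a0 that])
      moreover have "Phi u0 + inner (gPhi u0) (y - u0) \<le> Phi y"
        by (rule smooth_convex.above_tangent[OF smooth(1)])
      ultimately show ?thesis by (simp add: inner_diff_right)
    qed
    show "(\<Sum>n. ereal (lam (Suc n) * bet (Suc n)) *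
         (fenchel_conj (\<lambda>y. ereal (Psi1 y) + Psi2 y) (z /\<^sub>R bet (Suc n))
            - support_fun C (z /\<^sub>R bet (Suc n)))) < \<infinity>" if "z \<in> normal_cone C u0" for z
      by (rule c) (use that in blast)
    show "\<not> summable lam"
    proof
      assume "summable lam"
      then have s: "summable (\<lambda>n. lam (Suc n))" by (simp add: summable_Suc_iff)
      have "0 \<le> lam (Suc n)" for n using \<open>\<And>n. n \<ge> 1 \<Longrightarrow> lam n > 0\<close>[of "Suc n"] by simp
      then show False using d(1) suminf_ereal_finite[OF s] by simp
    qed
    show "summable (\<lambda>n. LPhi * (lam n)\<^sup>2)"
      using d(2) by (subst summable_Suc_iff[symmetric])
  qed (fact | simp add: nonneg C_eq vw)+
  have S: "S = minimizers" by (simp add: S_eq minimizers_def)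
  have pen0: "pen n = 0" if case_iii for n
    unfolding pen_def using that by (simp add: case_iii_def)
  have pen: "pen \<longlonglongrightarrow> 0"
  proof (cases case_iii)
    case True
    from pen0[OF this] have "pen = (\<lambda>_. 0)" by (rule ext)
    then show ?thesis by (metis tendsto_const)
  next
    case False
    then show ?thesis
      using \<open>case_i \<or> case_ii \<or> case_iii\<close> pen_tendsto_zero by (auto simp: case_i_def case_ii_def)
  qed
  have gap_small: "eventually (\<lambda>n. gap n \<le> e) sequentially" if "case_ii \<or> case_iii" "0 < e" for e
  proof -
    have "\<exists>K>0. \<forall>n\<ge>1. (bet (Suc n) - bet n) * pen (Suc n) \<le> K * lam (Suc n) * bet (Suc n) * pen (Suc n)"
    proof (cases case_iii)
      case True
      then show ?thesis by (intro exI[of _ 1]) (simp only: pen0 mult_zero_right order_refl zero_less_one simp_thms)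
    next
      case False
      then have case_ii using that(1) by blast
      then obtain K where "K > 0" "\<forall>n\<ge>1. bet (n + 1) - bet n \<le> K * lam (n + 1) * bet (n + 1)"
        unfolding case_ii_def by blast
      then show ?thesis using pen_nonneg by (intro exI[of _ K]) (auto intro!: mult_right_mono)
    qed
    then show ?thesis using limsup_gap_nonpos[OF _ _ that(2)] by blast
  qed
  have value_limit: "\<exists>m. is_min_on F C m \<and> (\<lambda>n. F (x n)) \<longlonglongrightarrow> m" if "case_ii \<or> case_iii"
  proof (intro exI conjI)
    show "is_min_on F C (F u0)" using u0(1) u0_minimal by (auto simp: is_min_on_def)
    let ?c = "Phi u0 + real_of_ereal (Phi2 u0)"
    have "(\<lambda>n. ereal (gap n + ?c)) \<longlonglongrightarrow> ereal (0 + ?c)"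
      by (intro tendsto_intros tendsto_ereal gap_tendsto_zero pen gap_small that)
    moreover have "eventually (\<lambda>n. ereal (gap n + ?c) = F (x n)) sequentially"
      using eventually_ge_at_top[of 2] by eventually_elim (simp only: F_iterate)
    ultimately show "(\<lambda>n. F (x n)) \<longlonglongrightarrow> F u0"
      unfolding F_u0 by (subst (asm) tendsto_cong) simp_all
  qed
  have "\<exists>xbar\<in>S. weakly_converges x xbar \<and> (case_i \<longrightarrow> x \<longlonglongrightarrow> xbar)"
  proof (cases case_i)
    case True
    then obtain u where u: "u \<in> minimizers" "x \<longlonglongrightarrow> u"
      using strong_convergence[OF pen] by (auto simp: case_i_def)
    moreover have "weakly_converges x u"
      unfolding weakly_converges_def by (intro allI tendsto_intros u)
    ultimately show ?thesis unfolding S by blast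
  next
    case False
    then have "case_ii \<or> case_iii" using \<open>case_i \<or> case_ii \<or> case_iii\<close> by blast
    then obtain u where "u \<in> minimizers" "weakly_converges x u"
      using weak_convergence[OF pen gap_small] by blast
    then show ?thesis using False unfolding S by blast
  qed
  then show ?thesis using value_limit by blast
qed

end
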